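(* Let $(X,\mathbb R^d,\mu)$ be a uniformly discrete, $m$-coloured stationary ergodic point process, let $w\in\mathbb R^m$ be a system of weights, and let $k\in\mathbb R^d$. Limits below are taken in the norm of $L^2(X,\mu)$, expressions in $\lambda$ being regarded as functions of $\lambda\in X$. The following are equivalent: (i) $\displaystyle\frac1{\ell(C_R)}\sum_{x\in C_R}\lambda^w(\{x\})\,e^{2\pi i k\cdot x}\nrightarrow 0$ as $R\to\infty$; (ii) $\widehat{\dot\mu^w_1}(\{k\})\ne0$; (iii) $k$ is an eigenvalue of $U$. In the case that $k$ is an eigenvalue, $$\frac1{\ell(C_R)}\sum_{x\in C_R}\lambda^w(\{x\})\,e^{2\pi i k\cdot x}\longrightarrow\theta^w(\mathbf 1_{\{k\}})\quad\text{as }R\to\infty.$$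
   Context: Fix $d,m\ge1$ and let $\mathbb E=\mathbb R^d\times\{1,\dots,m\}$ (second factor discrete), with $t+(x,i):=(t+x,i)$ for $t\in\mathbb R^d$. $C_R$ is the open cube of edge length $R$ centred at $0$ in $\mathbb R^d$; $\ell$ is Lebesgue measure. $M_p$ is the set of positive Radon measures $\lambda$ on $\mathbb E$ with $\lambda(A)\in\{0,1,2,\dots\}$ for every relatively compact Borel set $A$, with the vague topology ($\lambda_n\to\lambda$ iff $\lambda_n(f)\to\lambda(f)$ for all $f\in C_c(\mathbb E)$) and its Borel $\sigma$-algebra; $\mathbb R^d$ acts by $(T_t\lambda)(A)=\lambda(-t+A)$. For $r>0$, $M_p(C_r^{(m)},1)$ is the (compact) set of $\lambda\in M_p$ with $\lambda((a+C_r)\times\{1,\dots,m\})\le1$ for all $a\in\mathbb R^d$. An $m$-coloured uniformly discrete stationary ergodic point process $(X,\mathbb R^d,\mu)$ is a Borel probability measure $\mu$ on $M_p$, invariant and ergodic under all $T_t$, whose support $X$ is a closed subset of $M_p(C_r^{(m)},1)$ for some $r>0$. For $\lambda\in X$ let $\lambda^i$ be the measure on $\mathbb R^d$ given by $\lambda^i(A)=\lambda(A\times\{i\})$; it is assumed throughout that for each $i$ the constant $I^{(i)}$ with $\int_X\lambda^i(A)\,d\mu(\lambda)=I^{(i)}\ell(A)$ is positive. For a system of weights $w\in\mathbb R^m$ put $\lambda^w=\sum_i w_i\lambda^i$ (a signed measure on $\mathbb R^d$). The $w$-weighted Palm measure $\dot\mu^w$ is the finite signed measure on $X$ given by $\dot\mu^w(D)=\frac1{\ell(B)}\int_X\sum_{x\in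 B}\lambda^w(\{x\})\mathbf 1_D(T_{-x}\lambda)\,d\mu(\lambda)$, independent of the choice of bounded Borel $B\subset\mathbb R^d$ with $\ell(B)>0$. $\mathbb S$ is the space of rapidly decreasing functions on $\mathbb R^d$. For $f\in C_c(\mathbb R^d)$ or $f\in\mathbb S$, $N^w_f(\lambda)=\lambda^w(f)=\sum_{x\in\mathbb R^d}\lambda^w(\{x\})f(x)$. The weighted first moment of $\dot\mu^w$ is the measure $\dot\mu^w_1$ on $\mathbb R^d$ with $\dot\mu^w_1(f)=\dot\mu^w(N^w_f)$, $f\in C_c(\mathbb R^d)$; it is positive definite, and its Fourier transform $\widehat{\dot\mu^w_1}$ (determined by $\widehat{\dot\mu^w_1}(f)=\dot\mu^w_1(\hat f)$, $f\in\mathbb S$, with $\hat f(y)=\int e^{-2\pi i x\cdot y}f(x)\,dx$) is a positive translation bounded measure. $U$ is the unitary representation of $\mathbb R^d$ on $L^2(\mathbb R^d,\widehat{\dot\mu^w_1})$ given by $U_tf(x)=e^{-2\pi i t\cdot x}f(x)$; $k\in\mathbb R^d$ is an eigenvalue of $U$ if there is $f\ne0$ in this space with $U_tf=e^{2\pi i k\cdot t}f$ for all $t\in\mathbb R^d$. $\theta^w:L^2(\mathbb R^d,\widehat{\dot\mu^w_1})\to L^2(X,\mu)$ is the unique isometric embedding with $\theta^w(\hat f)=N^w_f$ for all $f\in\mathbb S$. *)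

theory Defs
  imports "HOL-Probability.Probability"
begin

text \<open>
  Throughout, \<open>'a\<close> is the Euclidean space on which the points live and \<open>'m\<close> is the finite, discrete
  set of colours, so that \<open>'a \<times> 'm\<close> with its product topology is the space of coloured points.
\<close>

definition cube :: "real \<Rightarrow> 'a::euclidean_space set" where
  "cube R = box (- (R / 2) *\<^sub>R One) ((R / 2) *\<^sub>R One)"

definition Cc :: "('a::topological_space \<Rightarrow> 'b::real_normed_vector) set" where
  "Cc = {f. continuous_on UNIV f \<and> compact (closure {x. f x \<noteq> 0})}"


subsection \<open>Integer-valued Radon measures and the vague topology\<close>

text \<open>
  On a locally compact space with a countable base every Borel measure that is finite on compact
  sets is regular, so finiteness on compact sets is all that ``Radon'' requires.
\<close>

definition Mp :: "('a::euclidean_space \<times> 'm::{finite,discrete_topology}) measure set" where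
  "Mp = {L. sets L = sets borel \<and> (\<forall>K. compact K \<longrightarrow> emeasure L K < \<infinity>) \<and>
            (\<forall>A\<in>sets borel. compact (closure A) \<longrightarrow> (\<exists>n::nat. emeasure L A = of_nat n))}"

definition vague_topology :: "('a::euclidean_space \<times> 'm::{finite,discrete_topology}) measure topology" where
  "vague_topology = topology_generated_by
     {{L \<in> Mp. integral\<^sup>L L f \<in> U} | (f :: 'a \<times> 'm \<Rightarrow> real) U. f \<in> Cc \<and> open U}"

definition vague_borel :: "('a::euclidean_space \<times> 'm::{finite,discrete_topology}) measure measure" where
  "vague_borel = sigma Mp {U. openin vague_topology U}"

text \<open>The preimage of \<open>A\<close> under \<open>(x, i) \<mapsto> (t + x, i)\<close> is \<open>-t + A\<close>.\<close>

definition shift :: "'a::euclidean_space \<Rightarrow> ('a \<times> 'm::{finite,discrete_topology}) measure \<Rightarrow> ('a \<times> 'm) measure" where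
  "shift t L = distr L borel (\<lambda>(x, i). (t + x, i))"

definition Mp_cube :: "real \<Rightarrow> ('a::euclidean_space \<times> 'm::{finite,discrete_topology}) measure set" where
  "Mp_cube r = {L \<in> Mp. \<forall>a. emeasure L (((+) a ` cube r) \<times> UNIV) \<le> 1}"

definition colour_part :: "('a::euclidean_space \<times> 'm::{finite,discrete_topology}) measure \<Rightarrow> 'm \<Rightarrow> 'a measure" where
  "colour_part L i = measure_of UNIV (sets borel) (\<lambda>A. emeasure L (A \<times> {i}))"


subsection \<open>Point processes\<close>

text \<open>The support is the smallest closed set of full measure.\<close>

definition is_support ::
  "('a::euclidean_space \<times> 'm::{finite,discrete_topology}) measure measure \<Rightarrow> ('a \<times> 'm) measure set \<Rightarrow> bool" where
  "is_support \<mu> X \<longleftrightarrow>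
     closedin vague_topology X \<and> emeasure \<mu> (Mp - X) = 0 \<and>
     (\<forall>C. closedin vague_topology C \<and> emeasure \<mu> (Mp - C) = 0 \<longrightarrow> X \<subseteq> C)"

definition ergodic_stationary ::
  "('a::euclidean_space \<times> 'm::{finite,discrete_topology}) measure measure \<Rightarrow> bool" where
  "ergodic_stationary \<mu> \<longleftrightarrow>
     (\<forall>t. distr \<mu> \<mu> (shift t) = \<mu>) \<and>
     (\<forall>D\<in>sets \<mu>. (\<forall>t. shift t -` D \<inter> space \<mu> = D) \<longrightarrow> emeasure \<mu> D = 0 \<or> emeasure \<mu> D = 1)"

definition point_process ::
  "('a::euclidean_space \<times> 'm::{finite,discrete_topology}) measure set \<Rightarrow> ('a \<times> 'm) measure measure \<Rightarrow> bool" where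
  "point_process X \<mu> \<longleftrightarrow>
     sets \<mu> = sets vague_borel \<and> prob_space \<mu> \<and> ergodic_stationary \<mu> \<and>
     is_support \<mu> X \<and> (\<exists>r>0. X \<subseteq> Mp_cube r) \<and>
     (\<forall>i. \<exists>I::real. I > 0 \<and>
        (\<forall>A\<in>sets borel. (\<integral>\<^sup>+L. emeasure (colour_part L i) A \<partial>restrict_space \<mu> X)
                          = ennreal I * emeasure lborel A))"


subsection \<open>Signed measures\<close>

text \<open>
  A signed measure is a real-valued set function \<open>\<nu>\<close> on a family \<open>R\<close> of measurable sets of \<open>M\<close>: all
  measurable sets for a finite signed measure, the bounded Borel sets for a signed Radon measure.
  Only the space and the measurable sets of \<open>M\<close> matter.  The set function \<open>pos_variation M R \<nu>\<close> is the positive part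
  in the Jordan decomposition; negative values of \<open>\<nu>\<close> are truncated to 0 by \<open>ennreal\<close>, harmlessly because of
  the competitor \<open>B = {}\<close>.
\<close>

definition pos_variation :: "'b measure \<Rightarrow> 'b set set \<Rightarrow> ('b set \<Rightarrow> real) \<Rightarrow> 'b measure" where
  "pos_variation M R \<nu> =
     measure_of (space M) (sets M) (\<lambda>A. SUP B\<in>{B\<in>R. B \<subseteq> A}. ennreal (\<nu> B))"

definition signed_integral :: "'b measure \<Rightarrow> 'b set set \<Rightarrow> ('b set \<Rightarrow> real) \<Rightarrow> ('b \<Rightarrow> complex) \<Rightarrow> complex" where
  "signed_integral M R \<nu> f =
     integral\<^sup>L (pos_variation M R \<nu>) f - integral\<^sup>L (pos_variation M R (\<lambda>A. - \<nu> A)) f"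

definition bounded_borel :: "'a::euclidean_space set set" where
  "bounded_borel = {A \<in> sets borel. bounded A}"

definition signed_radon :: "('a::euclidean_space set \<Rightarrow> real) \<Rightarrow> bool" where
  "signed_radon \<nu> \<longleftrightarrow>
     (\<forall>A :: nat \<Rightarrow> 'a set. range A \<subseteq> bounded_borel \<and> disjoint_family A \<and> bounded (\<Union>n. A n) \<longrightarrow>
        (\<lambda>n. \<nu> (A n)) sums \<nu> (\<Union>n. A n))"


subsection \<open>Weights, Palm measure and first moment\<close>

text \<open>The signed measure \<open>\<lambda>\<^sup>w\<close>; only its values on bounded Borel sets are meaningful.\<close>

definition wmeasure ::
  "real ^ 'm::{finite,discrete_topology} \<Rightarrow> ('a::euclidean_space \<times> 'm::{finite,discrete_topology}) measure \<Rightarrow> 'a set \<Rightarrow> real" where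
  "wmeasure w L A = (\<Sum>i\<in>UNIV. w $ i * measure (colour_part L i) A)"

definition counting_fun ::
  "real ^ 'm::{finite,discrete_topology} \<Rightarrow> ('a \<Rightarrow> complex) \<Rightarrow> ('a::euclidean_space \<times> 'm::{finite,discrete_topology}) measure \<Rightarrow> complex" where
  "counting_fun w f L = (\<Sum>\<^sub>\<infinity>x. of_real (wmeasure w L {x}) * f x)"

text \<open>
  In the following \<open>P\<close> is the probability measure \<open>\<mu>\<close> regarded as a measure on the space \<open>X\<close>. The Palm measure does
  not depend on the bounded Borel set of positive volume over which one averages; the unit cube is used.
\<close>

definition palm ::
  "('a::euclidean_space \<times> 'm::{finite,discrete_topology}) measure measure \<Rightarrow> real ^ 'm::{finite,discrete_topology} \<Rightarrow> ('a \<times> 'm) measure set \<Rightarrow> real" where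
  "palm P w D =
     (\<integral>L. (\<Sum>\<^sub>\<infinity>x\<in>cube 1. wmeasure w L {x} * indicator D (shift (- x) L)) \<partial>P)
       / measure lborel (cube 1 :: 'a set)"

definition is_first_moment ::
  "('a::euclidean_space \<times> 'm::{finite,discrete_topology}) measure measure \<Rightarrow> real ^ 'm::{finite,discrete_topology} \<Rightarrow> ('a set \<Rightarrow> real) \<Rightarrow> bool" where
  "is_first_moment P w \<nu> \<longleftrightarrow>
     signed_radon \<nu> \<and>
     (\<forall>f\<in>Cc. signed_integral borel bounded_borel \<nu> f
               = signed_integral P (sets P) (palm P w) (counting_fun w f))"


subsection \<open>Rapidly decreasing functions and Fourier transforms\<close>

primrec iter_partial :: "'a list \<Rightarrow> ('a::euclidean_space \<Rightarrow> complex) \<Rightarrow> 'a \<Rightarrow> complex" where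
  "iter_partial [] f = f"
| "iter_partial (b # bs) f = (\<lambda>x. frechet_derivative (iter_partial bs f) (at x) b)"

definition schwartz :: "('a::euclidean_space \<Rightarrow> complex) set" where
  "schwartz = {f. \<forall>bs\<in>lists Basis.
     (\<forall>x. iter_partial bs f differentiable at x) \<and>
     (\<forall>N::nat. \<exists>C. \<forall>x. norm x ^ N * norm (iter_partial bs f x) \<le> C)}"

definition fourier :: "('a::euclidean_space \<Rightarrow> complex) \<Rightarrow> 'a \<Rightarrow> complex" where
  "fourier f y = (\<integral>x. cis (- 2 * pi * (x \<bullet> y)) * f x \<partial>lborel)"

definition translation_bounded :: "'a::euclidean_space measure \<Rightarrow> bool" where
  "translation_bounded \<rho> \<longleftrightarrow>
     (\<forall>K. compact K \<longrightarrow> (\<exists>C::real. \<forall>t. emeasure \<rho> ((+) t ` K) \<le> ennreal C))"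

definition is_fourier_transform :: "('a::euclidean_space set \<Rightarrow> real) \<Rightarrow> 'a measure \<Rightarrow> bool" where
  "is_fourier_transform \<nu> \<rho> \<longleftrightarrow>
     sets \<rho> = sets borel \<and> translation_bounded \<rho> \<and>
     (\<forall>f\<in>schwartz. integral\<^sup>L \<rho> f = signed_integral borel bounded_borel \<nu> (fourier f))"


subsection \<open>Square-integrable functions\<close>

text \<open>Elements of \<open>L\<^sup>2\<close> are handled through representatives; equality in \<open>L\<^sup>2\<close> is equality almost everywhere.\<close>

definition L2 :: "'b measure \<Rightarrow> ('b \<Rightarrow> complex) set" where
  "L2 M = {f \<in> borel_measurable M. integrable M (\<lambda>x. (norm (f x))\<^sup>2)}"

definition L2_norm :: "'b measure \<Rightarrow> ('b \<Rightarrow> complex) \<Rightarrow> real" where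
  "L2_norm M f = sqrt (\<integral>x. (norm (f x))\<^sup>2 \<partial>M)"

definition L2_tendsto :: "'b measure \<Rightarrow> (real \<Rightarrow> 'b \<Rightarrow> complex) \<Rightarrow> ('b \<Rightarrow> complex) \<Rightarrow> bool" where
  "L2_tendsto M F g \<longleftrightarrow>
     (\<forall>\<^sub>F R in at_top. F R \<in> L2 M) \<and> g \<in> L2 M \<and>
     ((\<lambda>R. L2_norm M (\<lambda>x. F R x - g x)) \<longlongrightarrow> 0) at_top"

definition U_op :: "'a::euclidean_space \<Rightarrow> ('a \<Rightarrow> complex) \<Rightarrow> 'a \<Rightarrow> complex" where
  "U_op t f x = cis (- 2 * pi * (t \<bullet> x)) * f x"

definition U_eigenvalue :: "'a::euclidean_space measure \<Rightarrow> 'a \<Rightarrow> bool" where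
  "U_eigenvalue \<rho> k \<longleftrightarrow>
     (\<exists>f\<in>L2 \<rho>. \<not> (AE x in \<rho>. f x = 0) \<and>
        (\<forall>t. AE x in \<rho>. U_op t f x = cis (2 * pi * (k \<bullet> t)) * f x))"

text \<open>
  Linearity up to null sets together with the isometry property makes \<open>\<theta>\<close> well defined on classes
  of almost everywhere equal functions.
\<close>

definition is_theta ::
  "('a::euclidean_space \<times> 'm::{finite,discrete_topology}) measure measure \<Rightarrow> real ^ 'm::{finite,discrete_topology} \<Rightarrow> 'a measure \<Rightarrow>
   (('a \<Rightarrow> complex) \<Rightarrow> ('a \<times> 'm) measure \<Rightarrow> complex) \<Rightarrow> bool" where
  "is_theta P w \<rho> \<theta> \<longleftrightarrow>
     (\<forall>f\<in>L2 \<rho>. \<theta> f \<in> L2 P \<and> L2_norm P (\<theta> f) = L2_norm \<rho> f) \<and>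
     (\<forall>f\<in>L2 \<rho>. \<forall>g\<in>L2 \<rho>. \<forall>a b. AE L in P. \<theta> (\<lambda>x. a * f x + b * g x) L = a * \<theta> f L + b * \<theta> g L) \<and>
     (\<forall>f\<in>schwartz. AE L in P. \<theta> (fourier f) L = counting_fun w f L)"

definition weighted_average ::
  "real ^ 'm::{finite,discrete_topology} \<Rightarrow> 'a \<Rightarrow> real \<Rightarrow> ('a::euclidean_space \<times> 'm::{finite,discrete_topology}) measure \<Rightarrow> complex" where
  "weighted_average w k R L =
     (\<Sum>\<^sub>\<infinity>x\<in>cube R. of_real (wmeasure w L {x}) * cis (2 * pi * (k \<bullet> x)))
       / of_real (measure lborel (cube R :: 'a set))"

end

(*
  Let f_R be R^-d e^(2 pi i k.x) times a smooth function that is 1 on the cube C_R and 0 outside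
  C_(R+2). Its Fourier transform is a product of one-dimensional transforms, converges pointwise to
  the indicator of {k}, and integration by parts bounds its square, uniformly in R >= 1, by a multiple
  of prod_b 1 / (1 + (y_b - k_b)^2), which is integrable for every translation bounded measure. Hence
  the transforms converge to 1_{k} in L2(rho), and applying the isometry theta gives
  N_(f_R) -> theta(1_{k}) in L2(X, mu).

  The function N_(f_R) differs from the average over C_R only by the points in C_(R+2) - C_R; as the
  points of one colour are centres of disjoint cubes of edge length r, there are O(R^(d-1)) of them,
  so the difference is uniformly O(1/R). Thus the averages converge to theta(1_{k}), whose norm is
  the square root of rho {k}; this gives (i) <-> (ii) and the last claim.

  Eigenfunctions of U for k are supported on {-k}, so k is an eigenvalue iff rho {-k} is nonzero. The
  averages for k and -k are complex conjugate, so rho {-k} = rho {k}.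
*)

theory Submission
  imports Defs
begin

subsection \<open>Differentiable functions of one variable\<close>

text \<open>The isometry \<open>\<theta>\<close> is tied to sums over points only for Schwartz
  functions, so it says nothing directly about a sharp cube; this forces the smoothing. The ramps
  have length 1 for every R, which serves both ends: the derivative of the plateau has an L1 norm
  independent of R, so a single integration by parts suffices and even leaves a spare factor 1/R,
  while the added shell remains a thin boundary layer. Decay of order one in each coordinate is
  enough because L2 norms square it.

  Membership of the averages in L2 needs measurability in the configuration, and the vague topology
  only offers integrals of continuous functions of compact support. Hence integer-valued measures
  are shown to be atomic on bounded sets, sums over points are turned into integrals, and the open
  cube is approximated from inside by continuous functions.

  The symmetry of the atoms of \<open>\<rho>\<close> is not read off the Fourier transform; it is
  deduced from the criterion (i) \<longleftrightarrow> (ii) applied at k and at -k.\<close>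

text \<open>The derivative is existential, so each closure rule below is an induction on the order.
  Smoothness is this property for every \<open>n\<close>. The codomain is generic because real steps
  and complex waves are both needed.\<close>

primrec times_differentiable :: "nat \<Rightarrow> (real \<Rightarrow> 'b::real_normed_field) \<Rightarrow> bool" where
  "times_differentiable 0 f \<longleftrightarrow> True"
| "times_differentiable (Suc n) f \<longleftrightarrow>
     (\<exists>f'. (\<forall>x. (f has_vector_derivative f' x) (at x)) \<and> times_differentiable n f')"

lemma times_differentiable_SucI:
  "(\<And>x. (f has_vector_derivative f' x) (at x)) \<Longrightarrow> times_differentiable n f' \<Longrightarrow>
    times_differentiable (Suc n) f"
  by auto

lemma times_differentiable_Suc_imp:
  "times_differentiable (Suc n) f \<Longrightarrow> times_differentiable n f"
  by (induction n arbitrary: f) (simp, metis times_differentiable.simps(2))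

lemma times_differentiable_add:
  "times_differentiable n f \<Longrightarrow> times_differentiable n g \<Longrightarrow> times_differentiable n (\<lambda>x. f x + g x)"
proof (induction n arbitrary: f g)
  case (Suc n)
  then obtain f' g' where "\<forall>x. (f has_vector_derivative f' x) (at x)" "times_differentiable n f'"
     "\<forall>x. (g has_vector_derivative g' x) (at x)" "times_differentiable n g'"
    by auto
  with Suc.IH[of f' g'] show ?case
    by (auto intro!: exI[of _ "\<lambda>x. f' x + g' x"] has_vector_derivative_add)
qed simp

lemma times_differentiable_mult:
  "times_differentiable n f \<Longrightarrow> times_differentiable n g \<Longrightarrow> times_differentiable n (\<lambda>x. f x * g x)"
proof (induction n arbitrary: f g)
  case (Suc n)
  then obtain f' g' where fg: "\<forall>x. (f has_vector_derivative f' x) (at x)" "times_differentiable n f'"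
     "\<forall>x. (g has_vector_derivative g' x) (at x)" "times_differentiable n g'"
    by auto
  have "times_differentiable n (\<lambda>x. f x * g' x + f' x * g x)"
    using Suc.prems[THEN times_differentiable_Suc_imp]
    by (intro times_differentiable_add Suc.IH fg)
  with fg show ?case
    by (auto intro!: exI[of _ "\<lambda>x. f x * g' x + f' x * g x"] has_vector_derivative_mult)
qed simp

lemma times_differentiable_const: "times_differentiable n (\<lambda>_. c)"
  by (induction n arbitrary: c)
     (simp, rule times_differentiable_SucI[OF has_vector_derivative_const])

text \<open>The derivative of 1/f is a product of \<open>f'\<close> and two copies of 1/f, and 1/f
  has one order less by induction, so the product rule closes the step.\<close>

lemma times_differentiable_inverse:
  fixes f :: "real \<Rightarrow> real"
  assumes "\<And>x. f x \<noteq> 0"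
  shows "times_differentiable n f \<Longrightarrow> times_differentiable n (\<lambda>x. inverse (f x))"
proof (induction n)
  case (Suc n)
  then obtain f' where f': "\<forall>x. (f has_vector_derivative f' x) (at x)" "times_differentiable n f'"
    by auto
  have i: "times_differentiable n (\<lambda>x. inverse (f x))"
    by (rule Suc.IH[OF times_differentiable_Suc_imp[OF Suc.prems]])
  have "times_differentiable n (\<lambda>x. (-1) * (inverse (f x) * f' x * inverse (f x)))"
    by (intro times_differentiable_mult times_differentiable_const i f')
  with f' assms show ?case
    by (auto intro!: exI[of _ "\<lambda>x. (-1) * (inverse (f x) * f' x * inverse (f x))"] DERIV_inverse'
       simp flip: has_real_derivative_iff_has_vector_derivative)
qed simp

lemma times_differentiable_affine:
  "times_differentiable n f \<Longrightarrow> times_differentiable n (\<lambda>x. f (a * x + b))"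
proof (induction n arbitrary: f)
  case (Suc n)
  then obtain f' where f': "\<forall>x. (f has_vector_derivative f' x) (at x)" "times_differentiable n f'"
    by auto
  have "((\<lambda>x. f (a * x + b)) has_vector_derivative of_real a * f' (a * x + b)) (at x)" for x
  proof -
    have "((\<lambda>x. a * x + b) has_vector_derivative a) (at x)"
      unfolding has_real_derivative_iff_has_vector_derivative[symmetric]
      by (auto intro!: derivative_eq_intros)
    from vector_diff_chain_at[OF this f'(1)[rule_format, of "a * x + b"]]
    show ?thesis by (simp add: o_def scaleR_conv_of_real)
  qed
  moreover have "times_differentiable n (\<lambda>x. of_real a * f' (a * x + b))"
    by (intro times_differentiable_mult times_differentiable_const Suc.IH f')
  ultimately show ?case by (rule times_differentiable_SucI)
qed simp

lemma times_differentiable_of_real: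
  "times_differentiable n f \<Longrightarrow> times_differentiable n (\<lambda>x. complex_of_real (f x))"
proof (induction n arbitrary: f)
  case (Suc n)
  then obtain f' where f': "\<forall>x. (f has_vector_derivative f' x) (at x)" "times_differentiable n f'"
    by auto
  then show ?case using Suc.IH[of f']
    by (auto intro!: exI[of _ "\<lambda>x. complex_of_real (f' x)"] has_vector_derivative_of_real
      simp: has_real_derivative_iff_has_vector_derivative)
qed simp

lemma has_vector_derivative_cis:
  "((\<lambda>x. cis (c * x)) has_vector_derivative \<i> * of_real c * cis (c * x)) (at x)"
  unfolding cis_conv_exp
  by (auto intro!: derivative_eq_intros has_vector_derivative_real_field simp: algebra_simps)

lemma times_differentiable_cis: "times_differentiable n (\<lambda>x. cis (c * x))"
proof (induction n)
  case (Suc n)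
  have "times_differentiable n (\<lambda>x. \<i> * of_real c * cis (c * x))"
    by (intro times_differentiable_mult times_differentiable_const Suc.IH)
  then show ?case by (rule times_differentiable_SucI[OF has_vector_derivative_cis])
qed simp

subsection \<open>A smooth plateau\<close>

text \<open>For \<open>j = 0\<close> this is the classical smooth flat function exp(-1/t). The
  powers of 1/t are included because they appear on differentiation: the linear span of the family
  is closed under derivatives, so smoothness is an induction with \<open>j\<close>
  arbitrary.\<close>

definition flat_exp :: "nat \<Rightarrow> real \<Rightarrow> real" where
  "flat_exp j t = (if t > 0 then inverse t ^ j * exp (- inverse t) else 0)"

lemma flat_exp_tendsto_0: "(flat_exp j \<longlongrightarrow> 0) (at 0)"
proof -
  have "((\<lambda>t. inverse t ^ j / exp (inverse t)) \<longlongrightarrow> (0::real)) (at_right 0)"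
    by (rule filterlim_compose[OF tendsto_power_div_exp_0 filterlim_inverse_at_top_right])
  then have "(flat_exp j \<longlongrightarrow> 0) (at_right 0)"
    by (rule Lim_transform_eventually)
       (auto simp: flat_exp_def eventually_at_filter exp_minus divide_inverse)
  moreover have "(flat_exp j \<longlongrightarrow> 0) (at_left 0)"
    by (rule tendsto_eventually) (auto simp: flat_exp_def eventually_at_filter)
  ultimately show ?thesis by (simp add: filterlim_split_at)
qed

lemma flat_exp_DERIV:
  "(flat_exp j has_real_derivative (- real j) * flat_exp (j + 1) t + flat_exp (j + 2) t) (at t)"
proof -
  consider "t > 0" | "t < 0" | "t = 0" by linarith
  then show ?thesis
  proof cases
    case 1
    have "((\<lambda>t. inverse t ^ j * exp (- inverse t)) has_real_derivative
        (- real j) * flat_exp (j + 1) t + flat_exp (j + 2) t) (at t)"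
      using 1
      apply (cases j)
       apply (auto intro!: derivative_eq_intros simp: flat_exp_def algebra_simps power2_eq_square)
      subgoal for i by (cases i) auto
      done
    moreover have "eventually (\<lambda>s. s \<in> {0<..}) (nhds t)"
      using 1 by (intro eventually_nhds_in_open) auto
    ultimately show ?thesis
      by (subst DERIV_cong_ev[OF refl _ refl]) (auto simp: flat_exp_def elim!: eventually_mono)
  next
    case 2
    have "((\<lambda>_. 0) has_real_derivative
        (- real j) * flat_exp (j + 1) t + flat_exp (j + 2) t) (at t)"
      using 2 by (auto simp: flat_exp_def)
    moreover have "eventually (\<lambda>s. s \<in> {..<0}) (nhds t)"
      using 2 by (intro eventually_nhds_in_open) auto
    ultimately show ?thesis
      by (subst DERIV_cong_ev[OF refl _ refl]) (auto simp: flat_exp_def elim!: eventually_mono)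
  next
    case 3
    \<comment> \<open>At 0 the difference quotient of \<open>flat_exp j\<close> is
      \<open>flat_exp (Suc j)\<close> itself, which tends to 0.\<close>
    have "((\<lambda>y. (flat_exp j y - flat_exp j 0) / (y - 0)) \<longlongrightarrow> 0) (at 0)"
      by (rule Lim_transform_eventually[OF flat_exp_tendsto_0[of "Suc j"]])
         (auto simp: flat_exp_def eventually_at_filter divide_inverse)
    then show ?thesis using 3 by (simp add: has_field_derivative_iff flat_exp_def)
  qed
qed

lemma times_differentiable_flat_exp: "times_differentiable n (flat_exp j)"
proof (induction n arbitrary: j)
  case (Suc n)
  have "times_differentiable n (\<lambda>t. (- real j) * flat_exp (j + 1) t + flat_exp (j + 2) t)"
    by (intro times_differentiable_add times_differentiable_mult times_differentiable_const Suc.IH)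
  then show ?case
    by (rule times_differentiable_SucI[OF flat_exp_DERIV[unfolded has_real_derivative_iff_has_vector_derivative]])
qed simp

text \<open>The usual partition-of-unity quotient. Its denominator never vanishes, since
  \<open>t\<close> or \<open>1 - t\<close> is positive.\<close>

definition smooth_step :: "real \<Rightarrow> real" where
  "smooth_step t = flat_exp 0 t * inverse (flat_exp 0 t + flat_exp 0 (1 - t))"

lemma flat_exp_sum_pos: "flat_exp 0 t + flat_exp 0 (1 - t) > 0"
  by (auto simp: flat_exp_def add_pos_pos)

lemma smooth_step_bounds: "0 \<le> smooth_step t" "smooth_step t \<le> 1"
  using flat_exp_sum_pos[of t] unfolding smooth_step_def
  by (auto simp: field_simps flat_exp_def)

lemma smooth_step_eq_0: "t \<le> 0 \<Longrightarrow> smooth_step t = 0"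
  by (simp add: smooth_step_def flat_exp_def)

lemma smooth_step_eq_1: "t \<ge> 1 \<Longrightarrow> smooth_step t = 1"
  by (simp add: smooth_step_def flat_exp_def)

lemma times_differentiable_smooth_step: "times_differentiable n smooth_step"
proof -
  have e: "times_differentiable n (flat_exp 0)" by (rule times_differentiable_flat_exp)
  have "times_differentiable n (\<lambda>t. flat_exp 0 (1 - t))"
    using times_differentiable_affine[OF e, of "-1" 1] by simp
  then have "times_differentiable n (\<lambda>t. flat_exp 0 t + flat_exp 0 (1 - t))"
    by (intro times_differentiable_add e)
  moreover have "\<And>t. flat_exp 0 t + flat_exp 0 (1 - t) \<noteq> 0"
    using flat_exp_sum_pos by (metis less_irrefl)
  ultimately have "times_differentiable n (\<lambda>t. flat_exp 0 t * inverse (flat_exp 0 t + flat_exp 0 (1 - t)))"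
    by (intro times_differentiable_mult times_differentiable_inverse e)
  then show ?thesis by (simp add: smooth_step_def[abs_def])
qed

text \<open>A rising ramp on the left times a falling ramp on the right, each of length 1 and placed
  just outside the interval of length \<open>R\<close>.\<close>

definition plateau :: "real \<Rightarrow> real \<Rightarrow> real" where
  "plateau R s = smooth_step (s + (R / 2 + 1)) * smooth_step (R / 2 + 1 - s)"

lemma plateau_bounds: "0 \<le> plateau R s" "plateau R s \<le> 1"
  unfolding plateau_def using smooth_step_bounds by (auto intro: mult_le_one)

lemma plateau_eq_1: "\<bar>s\<bar> \<le> R / 2 \<Longrightarrow> plateau R s = 1"
  by (simp add: plateau_def smooth_step_eq_1)

lemma plateau_eq_0: "\<bar>s\<bar> \<ge> R / 2 + 1 \<Longrightarrow> plateau R s = 0"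
  unfolding plateau_def by (cases "s \<ge> 0") (auto simp: smooth_step_eq_0)

lemma times_differentiable_plateau: "times_differentiable n (plateau R)"
proof -
  have "times_differentiable n (\<lambda>s. smooth_step (1 * s + (R / 2 + 1)) * smooth_step (-1 * s + (R / 2 + 1)))"
    by (intro times_differentiable_mult times_differentiable_affine times_differentiable_smooth_step)
  then show ?thesis by (simp add: plateau_def[abs_def] algebra_simps)
qed

subsection \<open>Product functions and their Fourier transforms\<close>

text \<open>Partial derivatives of a product over coordinates are again such products, in which each
  factor has been differentiated as often as its direction occurs in the list. They are continuous
  and vanish outside a compact box, so multiplying by any power of the norm keeps them
  bounded.\<close>

lemma schwartz_prod:
  fixes \<phi> :: "'a::euclidean_space \<Rightarrow> real \<Rightarrow> complex"
  assumes smooth: "\<And>b n. b \<in> Basis \<Longrightarrow> times_differentiable n (\<phi> b)"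
    and supp: "\<And>b s. b \<in> Basis \<Longrightarrow> \<bar>s\<bar> > M \<Longrightarrow> \<phi> b s = 0"
  shows "(\<lambda>x. \<Prod>b\<in>Basis. \<phi> b (x \<bullet> b)) \<in> schwartz"
proof -
  define D where "D f x = vector_derivative f (at x)" for f :: "real \<Rightarrow> complex" and x
  define \<psi> where "\<psi> b n = (D ^^ n) (\<phi> b)" for b n
  have D: "times_differentiable n (D f)" "(f has_vector_derivative D f x) (at x)"
    if "times_differentiable (Suc n) f" for f n x
  proof -
    from that obtain f' where f': "\<And>x. (f has_vector_derivative f' x) (at x)" "times_differentiable n f'"
      by auto
    then have "D f = f'" by (auto simp: D_def fun_eq_iff intro: vector_derivative_at)
    with f' show "times_differentiable n (D f)" "(f has_vector_derivative D f x) (at x)" by auto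
  qed
  have td: "times_differentiable n (\<psi> b m)" if "b \<in> Basis" for b n m
  proof (induction m arbitrary: n)
    case 0
    then show ?case using smooth[OF that] by (simp add: \<psi>_def)
  next
    case (Suc m)
    then show ?case using D(1)[OF Suc[of "Suc n"]] by (simp add: \<psi>_def)
  qed
  have \<psi>_deriv: "(\<psi> b n has_vector_derivative \<psi> b (Suc n) x) (at x)" if "b \<in> Basis" for b n x
    using D(2)[OF td[OF that, of "Suc 0" n]] by (simp add: \<psi>_def)
  have \<psi>_0: "\<psi> b n s = 0" if "b \<in> Basis" "\<bar>s\<bar> > M" for b n s
    using that(2)
  proof (induction n arbitrary: s)
    case 0
    then show ?case using supp[OF that(1)] by (simp add: \<psi>_def)
  next
    case (Suc n)
    have "open {s::real. \<bar>s\<bar> > M}" by (intro open_Collect_less continuous_intros)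
    then have "((\<lambda>_. 0) has_vector_derivative \<psi> b (Suc n) s) (at s)"
      by (rule has_vector_derivative_transform_within_open[OF \<psi>_deriv[OF that(1), of n s]])
         (use Suc in auto)
    then show ?case
      using vector_derivative_unique_at has_vector_derivative_const by blast
  qed
  have deriv: "((\<lambda>x. \<Prod>b\<in>Basis. \<psi> b (m b) (x \<bullet> b)) has_derivative
     (\<lambda>y. \<Sum>i\<in>Basis. ((y \<bullet> i) *\<^sub>R \<psi> i (Suc (m i)) (x \<bullet> i)) * (\<Prod>j\<in>Basis - {i}. \<psi> j (m j) (x \<bullet> j)))) (at x)"
    for m and x :: 'a
  proof (rule has_derivative_prod)
    fix i :: 'a assume i: "i \<in> Basis"
    have "((\<lambda>x. x \<bullet> i) has_derivative (\<lambda>y. y \<bullet> i)) (at x)"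
      by (auto intro!: derivative_eq_intros)
    from has_derivative_compose[OF this \<psi>_deriv[OF i, unfolded has_vector_derivative_def]]
    show "((\<lambda>x. \<psi> i (m i) (x \<bullet> i)) has_derivative (\<lambda>y. (y \<bullet> i) *\<^sub>R \<psi> i (Suc (m i)) (x \<bullet> i))) (at x)"
      by simp
  qed
  \<comment> \<open>The order of the directions is irrelevant; only their multiplicities
    \<open>count_list bs b\<close> matter. In the product rule all summands but the one for
    \<open>c\<close> vanish, because \<open>c\<close> is orthogonal to the other basis
    vectors.\<close>
  have iter: "iter_partial bs (\<lambda>x. \<Prod>b\<in>Basis. \<phi> b (x \<bullet> b)) =
      (\<lambda>x. \<Prod>b\<in>Basis. \<psi> b (count_list bs b) (x \<bullet> b))" if "bs \<in> lists Basis" for bs :: "'a list"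
    using that
  proof (induction bs)
    case Nil
    then show ?case by (simp add: \<psi>_def)
  next
    case (Cons c bs)
    then have c: "c \<in> Basis" by simp
    have "frechet_derivative (\<lambda>x. \<Prod>b\<in>Basis. \<psi> b (count_list bs b) (x \<bullet> b)) (at x) c
        = (\<Prod>b\<in>Basis. \<psi> b (count_list (c # bs) b) (x \<bullet> b))" for x
    proof -
      have "frechet_derivative (\<lambda>x. \<Prod>b\<in>Basis. \<psi> b (count_list bs b) (x \<bullet> b)) (at x) c
        = (\<Sum>i\<in>Basis. ((c \<bullet> i) *\<^sub>R \<psi> i (Suc (count_list bs i)) (x \<bullet> i)) *
             (\<Prod>j\<in>Basis - {i}. \<psi> j (count_list bs j) (x \<bullet> j)))"
        by (subst frechet_derivative_at[OF deriv, symmetric]) simp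
      also have "\<dots> = (\<Sum>i\<in>Basis. if i = c then \<psi> c (Suc (count_list bs c)) (x \<bullet> c) *
             (\<Prod>j\<in>Basis - {c}. \<psi> j (count_list bs j) (x \<bullet> j)) else 0)"
        using c by (intro sum.cong) (auto simp: inner_Basis)
      also have "\<dots> = \<psi> c (Suc (count_list bs c)) (x \<bullet> c) *
             (\<Prod>j\<in>Basis - {c}. \<psi> j (count_list bs j) (x \<bullet> j))"
        using c by simp
      also have "\<dots> = (\<Prod>b\<in>Basis. \<psi> b (count_list (c # bs) b) (x \<bullet> b))"
      proof -
        have "(\<Prod>j\<in>Basis - {c}. \<psi> j (count_list bs j) (x \<bullet> j)) =
            (\<Prod>b\<in>Basis - {c}. \<psi> b (count_list (c # bs) b) (x \<bullet> b))"
          by (rule prod.cong) auto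
        then show ?thesis using c by (subst (2) prod.remove[of _ c]) auto
      qed
      finally show ?thesis .
    qed
    moreover have "iter_partial bs (\<lambda>x. \<Prod>b\<in>Basis. \<phi> b (x \<bullet> b)) =
        (\<lambda>x. \<Prod>b\<in>Basis. \<psi> b (count_list bs b) (x \<bullet> b))"
      using Cons by simp
    ultimately show ?case unfolding iter_partial.simps by presburger
  qed
  show ?thesis
    unfolding schwartz_def
  proof (intro CollectI ballI conjI allI)
    fix bs :: "'a list" assume bs: "bs \<in> lists Basis"
    show "iter_partial bs (\<lambda>x. \<Prod>b\<in>Basis. \<phi> b (x \<bullet> b)) differentiable at x" for x
      unfolding iter[OF bs] differentiable_def using deriv by blast
    fix N :: nat
    let ?g = "\<lambda>x::'a. norm x ^ N * norm (\<Prod>b\<in>Basis. \<psi> b (count_list bs b) (x \<bullet> b))"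
    let ?K = "cbox (- \<bar>M\<bar> *\<^sub>R One) (\<bar>M\<bar> *\<^sub>R One) :: 'a set"
    have "continuous_on UNIV (\<lambda>x::'a. \<Prod>b\<in>Basis. \<psi> b (count_list bs b) (x \<bullet> b))"
      using has_derivative_continuous[OF deriv] by (auto simp: continuous_on_eq_continuous_within)
    then have "continuous_on ?K (\<lambda>x. \<Prod>b\<in>Basis. \<psi> b (count_list bs b) (x \<bullet> b))"
      by (rule continuous_on_subset) auto
    then have "continuous_on ?K ?g"
      by (intro continuous_on_mult continuous_on_norm continuous_on_power continuous_on_id)
    then have "compact (?g ` ?K)" by (intro compact_continuous_image compact_cbox)
    then have "bdd_above (?g ` ?K)"
      by (intro bounded_imp_bdd_above compact_imp_bounded)
    then obtain C where C: "\<And>x. x \<in> ?K \<Longrightarrow> ?g x \<le> C"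
      by (auto simp: bdd_above_def)
    have "?g x \<le> max C 0" for x
    proof (cases "x \<in> ?K")
      case True
      with C[OF this] show ?thesis by simp
    next
      case False
      then obtain b where "b \<in> Basis" "\<not> (- \<bar>M\<bar> \<le> x \<bullet> b \<and> x \<bullet> b \<le> \<bar>M\<bar>)"
        by (auto simp: mem_box)
      then have b: "b \<in> Basis" "\<bar>x \<bullet> b\<bar> > M" by linarith+
      then have "(\<Prod>b\<in>Basis. \<psi> b (count_list bs b) (x \<bullet> b)) = 0"
        using \<psi>_0[OF b] by (intro prod_zero bexI[of _ b]) auto
      then show ?thesis by (simp only: norm_zero mult_zero_right max.cobounded2)
    qed
    then show "\<exists>C. \<forall>x. norm x ^ N * norm (iter_partial bs (\<lambda>x. \<Prod>b\<in>Basis. \<phi> b (x \<bullet> b)) x) \<le> C"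
      unfolding iter[OF bs] by blast
  qed
qed

text \<open>The step is locally constant off the unit interval, so its derivative vanishes there,
  and on the interval continuity and compactness give a bound. The constant \<open>K\<close> is
  never computed; what matters is that it is fixed before \<open>R\<close>.\<close>

lemma smooth_step_deriv:
  obtains g K where "\<And>t. (smooth_step has_real_derivative g t) (at t)" "continuous_on UNIV g"
    "\<And>t. \<bar>g t\<bar> \<le> K * indicator {0..1} t" "K \<ge> 0"
proof -
  \<comment> \<open>Two orders are taken so that the derivative \<open>g\<close> is itself
    differentiable, hence continuous.\<close>
  obtain g h where g: "\<And>t. (smooth_step has_vector_derivative g t) (at t)"
    and h: "\<And>t. (g has_vector_derivative h t) (at t)"
    using times_differentiable_smooth_step[of "Suc (Suc 0)"] by auto
  have cont: "continuous_on UNIV g"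
    using h by (auto simp: continuous_on_eq_continuous_within
      intro!: has_derivative_continuous h[unfolded has_vector_derivative_def])
  have zero: "g t = 0" if "t < 0 \<or> t > 1" for t
  proof -
    obtain c :: real and S where S: "open S" "t \<in> S" "\<And>s. s \<in> S \<Longrightarrow> smooth_step s = c"
    proof (cases "t < 0")
      case True
      then show ?thesis using that[of "{..<0}" 0] smooth_step_eq_0 by auto
    next
      case False
      then show ?thesis using that[of "{1<..}" 1] \<open>t < 0 \<or> t > 1\<close> smooth_step_eq_1 by auto
    qed
    have "((\<lambda>_. c) has_vector_derivative g t) (at t)"
      by (rule has_vector_derivative_transform_within_open[OF g S(1,2)]) (use S in auto)
    then show ?thesis
      using vector_derivative_unique_at has_vector_derivative_const by blast
  qed
  have "compact (g ` {0..1})"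
    by (intro compact_continuous_image continuous_on_subset[OF cont]) auto
  then obtain K where K: "\<And>t. t \<in> {0..1} \<Longrightarrow> \<bar>g t\<bar> \<le> K"
    using compact_imp_bounded[of "g ` {0..1}"] unfolding bounded_iff
    by (metis image_eqI real_norm_def)
  show ?thesis
  proof (rule that)
    show "\<bar>g t\<bar> \<le> K * indicator {0..1} t" for t
      using K zero by (auto simp: indicator_def not_le)
    show "K \<ge> 0" using K[of 0] by auto
  qed (use g cont in \<open>auto simp: has_real_derivative_iff_has_vector_derivative\<close>)
qed

section \<open>The one-dimensional transform of the plateau: size, value at 0 and decay\<close>

lemma continuous_on_plateau: "continuous_on UNIV (plateau R)"
proof -
  obtain h where "\<And>t. (plateau R has_vector_derivative h t) (at t)"
    using times_differentiable_plateau[of "Suc 0"] by auto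
  then show ?thesis
    by (auto simp: continuous_on_eq_continuous_within has_vector_derivative_def
      intro!: has_derivative_continuous)
qed

lemma measurable_plateau [measurable]: "plateau R \<in> borel_measurable borel"
  using continuous_on_plateau by (rule borel_measurable_continuous_onI)

lemma plateau_le_indicator: "plateau R s \<le> indicator {-(R/2+1)..R/2+1} s"
  using plateau_bounds[of R s] plateau_eq_0[of R s] by (auto simp: indicator_def)

text \<open>The sign of the exponent is positive: the argument will be a coordinate of
  \<open>k - y\<close>, which absorbs both the wave of frequency \<open>k\<close> and the Fourier
  kernel. Dividing by \<open>R\<close> in each coordinate yields the factor R^-d of the
  average.\<close>

definition plateau_transform :: "real \<Rightarrow> real \<Rightarrow> complex" where
  "plateau_transform R u = (\<integral>s. of_real (plateau R s / R) * cis (2 * pi * u * s) \<partial>lborel)"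

lemma measurable_cis [measurable]: "cis \<in> borel_measurable borel"
  by (intro borel_measurable_continuous_onI continuous_intros)

lemma integrable_indicator_Icc: "integrable lborel (\<lambda>x. indicator {a..b::real} x :: real)"
  by (intro integrable_real_indicator) (auto simp: emeasure_lborel_Icc_eq)

lemma integrable_plateau_cis:
  "integrable lborel (\<lambda>s. of_real (plateau R s / R) * cis (c * s))"
proof (rule Bochner_Integration.integrable_bound)
  show "integrable lborel (\<lambda>s. indicator {-(R/2+1)..R/2+1} s / \<bar>R\<bar> :: real)"
    by (intro integrable_divide integrable_indicator_Icc)
  show "AE s in lborel. norm (of_real (plateau R s / R) * cis (c * s))
      \<le> norm (indicator {-(R/2+1)..R/2+1} s / \<bar>R\<bar> :: real)"
    using plateau_le_indicator[of R] plateau_bounds[of R]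
    by (auto simp: norm_mult norm_divide divide_right_mono simp flip: of_real_divide)
qed measurable

lemma measurable_plateau_transform [measurable]: "plateau_transform R \<in> borel_measurable borel"
  unfolding plateau_transform_def by measurable

text \<open>The support has length R + 2, and (R + 2)/R is at most 3 once R is at least 1.\<close>

lemma plateau_transform_bound:
  assumes "R \<ge> 1"
  shows "norm (plateau_transform R u) \<le> 3"
proof -
  have "norm (plateau_transform R u) \<le> (\<integral>s. norm (of_real (plateau R s / R) * cis (2 * pi * u * s)) \<partial>lborel)"
    unfolding plateau_transform_def by (rule integral_norm_bound)
  also have "\<dots> \<le> (\<integral>s. indicator {-(R/2+1)..R/2+1} s / R \<partial>lborel)"
    using plateau_le_indicator[of R] plateau_bounds[of R] assms
    by (intro integral_mono integrable_norm integrable_plateau_cis integrable_divide integrable_indicator_Icc)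
       (auto simp: norm_mult norm_divide divide_right_mono simp flip: of_real_divide)
  also have "\<dots> = (R + 2) / R" using assms by simp
  also have "\<dots> \<le> 3" using assms by (simp add: field_simps)
  finally show ?thesis .
qed

text \<open>The integral of the plateau lies between the lengths R and R + 2 of the two intervals
  that enclose it.\<close>

lemma plateau_transform_0:
  assumes "R \<ge> 1"
  shows "norm (plateau_transform R 0 - 1) \<le> 2 / R"
proof -
  have eq: "plateau_transform R 0 = of_real ((\<integral>s. plateau R s \<partial>lborel) / R)"
    unfolding plateau_transform_def by simp
  have int: "integrable lborel (plateau R)"
    by (rule Bochner_Integration.integrable_bound[OF integrable_indicator_Icc[of "-(R/2+1)" "R/2+1"]])
       (use plateau_le_indicator[of R] plateau_bounds[of R] in auto)
  have "(\<integral>s. plateau R s \<partial>lborel) \<le> (\<integral>s. indicator {-(R/2+1)..R/2+1} s \<partial>lborel)"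
    by (intro integral_mono int integrable_indicator_Icc plateau_le_indicator)
  then have 1: "(\<integral>s. plateau R s \<partial>lborel) \<le> R + 2" using assms by simp
  have "(\<integral>s. indicator {-(R/2)..R/2} s \<partial>lborel) \<le> (\<integral>s. plateau R s \<partial>lborel)"
    by (intro integral_mono int integrable_indicator_Icc)
       (use plateau_eq_1[of _ R] plateau_bounds[of R] in \<open>auto simp: indicator_def\<close>)
  then have 2: "R \<le> (\<integral>s. plateau R s \<partial>lborel)" using assms by simp
  have "norm (plateau_transform R 0 - 1) = \<bar>(\<integral>s. plateau R s \<partial>lborel) / R - 1\<bar>"
    unfolding eq by (metis norm_of_real of_real_1 of_real_diff)
  also have "\<dots> = ((\<integral>s. plateau R s \<partial>lborel) - R) / R" using 2 assms by (simp add: field_simps)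
  also have "\<dots> \<le> 2 / R" using 1 assms by (intro divide_right_mono) auto
  finally show ?thesis .
qed

text \<open>The boundary terms vanish, so multiplication by the frequency costs only the L1 norm of
  the derivative, at most \<open>2 * K\<close> for the two ramps; the factor 1/R is the
  normalisation. The estimate is used twice: with 1/R dropped it gives a bound uniform in R, and
  with 1/R kept it gives convergence to 0 at nonzero frequencies.\<close>

lemma plateau_transform_decay:
  obtains K where "K \<ge> 0" "\<And>R u. R \<ge> 1 \<Longrightarrow> \<bar>u\<bar> * norm (plateau_transform R u) \<le> K / R"
proof -
  obtain g K where g: "\<And>t. (smooth_step has_real_derivative g t) (at t)" "continuous_on UNIV g"
    "\<And>t. \<bar>g t\<bar> \<le> K * indicator {0..1} t" and K: "K \<ge> 0"
    using smooth_step_deriv by metis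
  show ?thesis
  proof (rule that[OF K])
    fix R u :: real assume R: "R \<ge> 1"
    define a where "a = R / 2 + 1"
    have a: "a \<ge> 1" using R by (simp add: a_def)
    define p where "p s = g (s + a) * smooth_step (a - s) - smooth_step (s + a) * g (a - s)" for s
    let ?I = "\<lambda>s. indicator {-a..a} s :: real"
    define F where "F s = of_real (plateau R s) * cis (2 * pi * u * s)" for s
    define F' where "F' s = of_real (p s) * cis (2 * pi * u * s)
        + \<i> * of_real (2 * pi * u) * F s" for s
    have dp: "(plateau R has_real_derivative p s) (at s)" for s
    proof -
      have 1: "((\<lambda>s. smooth_step (s + a)) has_real_derivative g (s + a) * 1) (at s)"
        by (rule DERIV_chain'[OF _ g(1), of "\<lambda>s. s + a" 1]) (auto intro!: derivative_eq_intros)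
      have 2: "((\<lambda>s. smooth_step (a - s)) has_real_derivative g (a - s) * -1) (at s)"
        by (rule DERIV_chain'[OF _ g(1), of "\<lambda>s. a - s" "-1"]) (auto intro!: derivative_eq_intros)
      have "((\<lambda>s. smooth_step (s + a) * smooth_step (a - s)) has_real_derivative p s) (at s)"
        by (rule DERIV_cong[OF DERIV_mult[OF 1 2]]) (simp add: p_def)
      then show ?thesis by (simp add: plateau_def[abs_def] a_def)
    qed
    have dF: "(F has_vector_derivative F' s) (at s)" for s
      unfolding F_def[abs_def]
      by (rule has_vector_derivative_eq_rhs[OF has_vector_derivative_mult
           [OF has_vector_derivative_of_real[OF dp] has_vector_derivative_cis]])
         (simp add: F'_def F_def algebra_simps)
    have cstep: "continuous_on UNIV smooth_step"
      using g(1) by (auto simp: continuous_on_eq_continuous_within intro: DERIV_isCont)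
    have cg: "continuous_on A (\<lambda>s. g (f s))" "continuous_on A (\<lambda>s. smooth_step (f s))"
      if "continuous_on A f" for A and f :: "real \<Rightarrow> real"
      using continuous_on_compose2[OF g(2) that] continuous_on_compose2[OF cstep that] by auto
    have cp: "continuous_on UNIV p"
      unfolding p_def by (intro continuous_intros cg)
    have cF: "continuous_on UNIV F"
      using dF by (auto simp: continuous_on_eq_continuous_within has_vector_derivative_def
        intro!: has_derivative_continuous)
    have cF': "continuous_on UNIV F'"
      unfolding F'_def by (intro continuous_intros cF cp)
    \<comment> \<open>Integration by parts; \<open>p\<close> is supported in two intervals of length 1 whatever \<open>R\<close> is.\<close>
    have "(\<integral>s. ?I s *\<^sub>R F' s \<partial>lborel) = F a - F (-a)"
      using a by (intro integral_FTC_atLeastAtMost) 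
        (auto intro: has_vector_derivative_at_within dF continuous_on_subset[OF cF'])
    also have "\<dots> = 0"
      using R by (simp add: F_def plateau_eq_0 a_def)
    finally have int0: "(\<integral>s. ?I s *\<^sub>R F' s \<partial>lborel) = 0" .
    have i1: "integrable lborel (\<lambda>s. ?I s *\<^sub>R (of_real (p s) * cis (2 * pi * u * s)))"
      by (intro borel_integrable_compact continuous_intros continuous_on_subset[OF cp]) auto
    have i2: "integrable lborel (\<lambda>s. ?I s *\<^sub>R F s)"
      by (intro borel_integrable_compact continuous_on_subset[OF cF]) auto
    have "(\<integral>s. ?I s *\<^sub>R F' s \<partial>lborel) = (\<integral>s. ?I s *\<^sub>R (of_real (p s) * cis (2 * pi * u * s))
         + \<i> * of_real (2 * pi * u) * (?I s *\<^sub>R F s) \<partial>lborel)"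
      unfolding F'_def by (intro Bochner_Integration.integral_cong) (auto simp: algebra_simps)
    also have "\<dots> = (\<integral>s. ?I s *\<^sub>R (of_real (p s) * cis (2 * pi * u * s)) \<partial>lborel)
         + \<i> * of_real (2 * pi * u) * (\<integral>s. ?I s *\<^sub>R F s \<partial>lborel)"
    proof -
      have i3: "integrable lborel (\<lambda>s. \<i> * of_real (2 * pi * u) * (?I s *\<^sub>R F s))"
        by (intro integrable_mult_right i2)
      show ?thesis
        by (simp only: Bochner_Integration.integral_add[OF i1 i3] integral_mult_right_zero)
    qed
    \<comment> \<open>The integral of \<open>F'\<close> is 0 and splits into the part from the ramps
      and the part from the wave, which are therefore opposite.\<close>
    finally have "\<i> * of_real (2 * pi * u) * (\<integral>s. ?I s *\<^sub>R F s \<partial>lborel)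
        = - (\<integral>s. ?I s *\<^sub>R (of_real (p s) * cis (2 * pi * u * s)) \<partial>lborel)"
      unfolding int0 by (rule minus_unique[OF sym, symmetric])
    then have "norm (\<i> * of_real (2 * pi * u) * (\<integral>s. ?I s *\<^sub>R F s \<partial>lborel))
        = norm (\<integral>s. ?I s *\<^sub>R (of_real (p s) * cis (2 * pi * u * s)) \<partial>lborel)"
      by (simp only: norm_minus_cancel)
    also have "\<dots> \<le> (\<integral>s. norm (?I s *\<^sub>R (of_real (p s) * cis (2 * pi * u * s))) \<partial>lborel)"
      by (rule integral_norm_bound)
    also have "\<dots> \<le> (\<integral>s. K * indicator {-a..1-a} s + K * indicator {a-1..a} s \<partial>lborel)"
    proof (intro integral_mono integrable_norm i1 Bochner_Integration.integrable_add
        integrable_mult_right integrable_indicator_Icc)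
      fix s
      have "\<bar>p s\<bar> \<le> \<bar>g (s + a)\<bar> * smooth_step (a - s) + smooth_step (s + a) * \<bar>g (a - s)\<bar>"
        unfolding p_def using abs_triangle_ineq4 smooth_step_bounds
        by (metis abs_mult abs_of_nonneg)
      also have "\<dots> \<le> \<bar>g (s + a)\<bar> * 1 + 1 * \<bar>g (a - s)\<bar>"
        by (intro add_mono mult_mono smooth_step_bounds) auto
      also have "\<dots> \<le> K * indicator {0..1} (s + a) + K * indicator {0..1} (a - s)"
        using g(3)[of "s + a"] g(3)[of "a - s"] by simp
      also have "\<dots> = K * indicator {-a..1-a} s + K * indicator {a-1..a} s"
        by (auto simp: indicator_def)
      finally have "\<bar>p s\<bar> \<le> K * indicator {-a..1-a} s + K * indicator {a-1..a} s" .
      moreover have "norm (?I s *\<^sub>R (of_real (p s) * cis (2 * pi * u * s))) \<le> \<bar>p s\<bar>"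
        by (auto simp: norm_mult indicator_def)
      ultimately show "norm (?I s *\<^sub>R (of_real (p s) * cis (2 * pi * u * s)))
          \<le> K * indicator {-a..1-a} s + K * indicator {a-1..a} s"
        by linarith
    qed
    also have "\<dots> = 2 * K"
      by (subst Bochner_Integration.integral_add)
         (auto intro!: integrable_mult_right integrable_indicator_Icc)
    finally have le: "2 * pi * \<bar>u\<bar> * norm (\<integral>s. ?I s *\<^sub>R F s \<partial>lborel) \<le> 2 * K"
      by (simp add: norm_mult abs_mult)
    have "plateau_transform R u = (\<integral>s. (?I s *\<^sub>R F s) / of_real R \<partial>lborel)"
      unfolding plateau_transform_def F_def using plateau_eq_0[of R]
      by (intro Bochner_Integration.integral_cong) (auto simp: indicator_def a_def)
    then have Q: "norm (plateau_transform R u) = norm (\<integral>s. ?I s *\<^sub>R F s \<partial>lborel) / R"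
      using R by (simp add: norm_divide)
    \<comment> \<open>The constant need not be sharp, so only \<open>pi\<close> being at least 1 is
      used to drop it.\<close>
    have "\<bar>u\<bar> * norm (\<integral>s. ?I s *\<^sub>R F s \<partial>lborel)
        \<le> pi * (\<bar>u\<bar> * norm (\<integral>s. ?I s *\<^sub>R F s \<partial>lborel))"
      using pi_gt3 mult_right_mono[of 1 pi "\<bar>u\<bar> * norm (\<integral>s. ?I s *\<^sub>R F s \<partial>lborel)"] by simp
    also have "\<dots> \<le> K" using le by simp
    finally show "\<bar>u\<bar> * norm (plateau_transform R u) \<le> K / R"
      unfolding Q using R by (simp add: divide_right_mono)
  qed
qed

section \<open>Fourier transforms in several coordinates\<close>

lemma cis_sum: "cis (\<Sum>b\<in>A. f b) = (\<Prod>b\<in>A. cis (f b))"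
  by (induction A rule: infinite_finite_induct) (auto simp flip: cis_mult)

text \<open>The character factorises over the coordinates and \<open>lborel\<close> is the image of
  a product of lines, so the integral of the product splits by Fubini.\<close>

lemma fourier_prod:
  fixes \<phi> :: "'a::euclidean_space \<Rightarrow> real \<Rightarrow> complex"
  assumes int: "\<And>b. b \<in> Basis \<Longrightarrow> integrable lborel (\<phi> b)"
  shows "fourier (\<lambda>x. \<Prod>b\<in>Basis. \<phi> b (x \<bullet> b)) y
    = (\<Prod>b\<in>Basis. \<integral>s. cis (- 2 * pi * (s * (y \<bullet> b))) * \<phi> b s \<partial>lborel)"
proof -
  interpret product_sigma_finite "\<lambda>_::'a. lborel :: real measure"
    by standard
  have \<phi> [measurable]: "b \<in> Basis \<Longrightarrow> \<phi> b \<in> borel_measurable borel" for b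
    using borel_measurable_integrable[OF int] by simp
  let ?h = "\<lambda>b s. cis (- 2 * pi * (s * (y \<bullet> b))) * \<phi> b s"
  have "fourier (\<lambda>x. \<Prod>b\<in>Basis. \<phi> b (x \<bullet> b)) y = (\<integral>x. (\<Prod>b\<in>Basis. ?h b (x \<bullet> b)) \<partial>lborel)"
    unfolding fourier_def
    by (intro Bochner_Integration.integral_cong refl)
       (subst euclidean_inner, simp add: sum_distrib_left cis_sum prod.distrib flip: sum_negf)
  also have "\<dots> = (\<integral>f. (\<Prod>b\<in>Basis. ?h b ((\<Sum>b\<in>Basis. f b *\<^sub>R b) \<bullet> b)) \<partial>(\<Pi>\<^sub>M b\<in>Basis. lborel))"
    by (subst lborel_eq, subst integral_distr) measurable
  also have "\<dots> = (\<integral>f. (\<Prod>b\<in>Basis. ?h b (f b)) \<partial>(\<Pi>\<^sub>M b\<in>Basis. lborel))"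
    by (intro Bochner_Integration.integral_cong prod.cong refl) simp
  also have "\<dots> = (\<Prod>b\<in>Basis. \<integral>s. ?h b s \<partial>lborel)"
  proof (rule product_integral_prod)
    fix b :: 'a assume b: "b \<in> Basis"
    show "integrable lborel (?h b)"
      by (rule Bochner_Integration.integrable_bound[OF int[OF b]])
         (use b in \<open>auto simp: norm_mult\<close>)
  qed simp
  finally show ?thesis .
qed

text \<open>The smoothed average kernel, with the normalisation and the character distributed over
  the coordinates so that the lemmas on product functions apply. Its collected form is
  \<open>plateau_wave_eq\<close>.\<close>

definition plateau_wave :: "'a::euclidean_space \<Rightarrow> real \<Rightarrow> 'a \<Rightarrow> complex" where
  "plateau_wave k R x = (\<Prod>b\<in>Basis. of_real (plateau R (x \<bullet> b) / R) * cis (2 * pi * (k \<bullet> b) * (x \<bullet> b)))"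

lemma fourier_plateau_wave:
  "fourier (plateau_wave k R) y = (\<Prod>b\<in>Basis. plateau_transform R ((k - y) \<bullet> b))"
  unfolding plateau_wave_def[abs_def]
  by (subst fourier_prod[OF integrable_plateau_cis])
     (auto intro!: prod.cong Bochner_Integration.integral_cong
       simp: plateau_transform_def cis_mult inner_diff_left algebra_simps)

subsection \<open>Translation bounded measures\<close>

lemma nn_integral_inverse_1_plus_square_finite: "(\<integral>\<^sup>+x. ennreal (inverse (1 + x^2)) \<partial>(lborel :: real measure)) < \<infinity>"
proof -
  have "integrable lborel (\<lambda>x::real. inverse (1 + x^2))"
    using integrable_inverse_1_plus_square by (simp add: set_integrable_def)
  then show ?thesis by (simp add: integrable_iff_bounded add_nonneg_nonneg)
qed

text \<open>Up to a constant, the density of independent Cauchy variables. A product is preferred to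
  a radial function because the estimates come one coordinate at a time and the Lebesgue integral
  factorises.\<close>

definition cauchy_kernel :: "'a::euclidean_space \<Rightarrow> real" where
  "cauchy_kernel y = (\<Prod>b\<in>Basis. inverse (1 + (y \<bullet> b)^2))"

lemma cauchy_kernel_nonneg: "cauchy_kernel y \<ge> 0"
  unfolding cauchy_kernel_def by (intro prod_nonneg) (auto simp: add_nonneg_nonneg)

lemma measurable_cauchy_kernel [measurable]: "cauchy_kernel \<in> borel_measurable borel"
  unfolding cauchy_kernel_def by measurable

text \<open>In each coordinate (y + t)^2 is at most 2 y^2 + 2 t^2, hence 1 + (y + t)^2 is at most 3
  (1 + y^2) for t in the unit interval. This lets a value of the kernel be replaced by its average
  over a unit cube.\<close>

lemma cauchy_kernel_shift:
  assumes "t \<in> cbox 0 (One :: 'a::euclidean_space)"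
  shows "cauchy_kernel y \<le> 3 ^ DIM('a) * cauchy_kernel (y + t)"
proof -
  have "cauchy_kernel y \<le> (\<Prod>b\<in>(Basis::'a set). 3 * inverse (1 + ((y + t) \<bullet> b)^2))"
    unfolding cauchy_kernel_def
  proof (intro prod_mono conjI)
    fix b :: 'a assume b: "b \<in> Basis"
    have t: "0 \<le> t \<bullet> b" "t \<bullet> b \<le> 1" using assms b by (auto simp: mem_box)
    have "(t \<bullet> b)^2 \<le> 1" using t by (simp add: power_le_one)
    moreover have "((y + t) \<bullet> b)^2 + (y \<bullet> b - t \<bullet> b)^2 = 2 * (y \<bullet> b)^2 + 2 * (t \<bullet> b)^2"
      by (simp add: inner_add_left power2_eq_square algebra_simps)
    moreover have "0 \<le> (y \<bullet> b - t \<bullet> b)^2" "0 \<le> (y \<bullet> b)^2" by simp_all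
    moreover have "1 + S \<le> 3 * (1 + Y)"
      if "T \<le> 1" "S + D = 2 * Y + 2 * T" "0 \<le> D" "0 \<le> Y" for S D Y T :: real
      using that by argo
    ultimately have "1 + ((y + t) \<bullet> b)^2 \<le> 3 * (1 + (y \<bullet> b)^2)"
      by blast
    then show "inverse (1 + (y \<bullet> b)^2) \<le> 3 * inverse (1 + ((y + t) \<bullet> b)^2)"
      by (simp add: field_simps add_pos_nonneg)
  qed (simp add: add_nonneg_nonneg)
  also have "\<dots> = 3 ^ DIM('a) * cauchy_kernel (y + t)"
    by (simp add: cauchy_kernel_def prod.distrib)
  finally show ?thesis .
qed

lemma translation_bounded_emeasure_compact:
  assumes "translation_bounded \<rho>" "compact K"
  shows "emeasure \<rho> K < \<infinity>"
proof -
  obtain C :: real where "\<And>t. emeasure \<rho> ((+) t ` K) \<le> ennreal C"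
    using assms unfolding translation_bounded_def by blast
  from this[of 0] have "emeasure \<rho> K \<le> ennreal C" by simp
  also have "\<dots> < \<infinity>" by simp
  finally show ?thesis .
qed

lemma translation_bounded_sigma_finite:
  fixes \<rho> :: "'a::euclidean_space measure"
  assumes "sets \<rho> = sets borel" "translation_bounded \<rho>"
  shows "sigma_finite_measure \<rho>"
proof
  let ?A = "range (\<lambda>n::nat. cball (0::'a) (real n))"
  have "\<Union>?A = UNIV" using real_arch_simple by (auto simp: subset_iff)
  then show "\<exists>A. countable A \<and> A \<subseteq> sets \<rho> \<and> \<Union> A = space \<rho> \<and> (\<forall>a\<in>A. emeasure \<rho> a \<noteq> \<infinity>)"
    using assms sets_eq_imp_space_eq[OF assms(1)] translation_bounded_emeasure_compact[OF assms(2)]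
    by (intro exI[of _ ?A]) (auto simp: less_top)
qed

text \<open>The value at \<open>y - k\<close> is dominated by \<open>3 ^ DIM('a)\<close> times the
  Lebesgue average over the adjacent unit cube. After exchanging the integrals, the inner one is the
  \<open>\<rho>\<close>-mass of a translated unit cube, bounded by a single constant, and what
  remains is the Lebesgue integral of the kernel, a product of integrals of 1/(1 + x^2).\<close>

lemma integrable_cauchy_kernel:
  fixes \<rho> :: "'a::euclidean_space measure"
  assumes sets: "sets \<rho> = sets borel" and tb: "translation_bounded \<rho>"
  shows "integrable \<rho> (\<lambda>y. cauchy_kernel (y - k))"
proof -
  have [measurable_cong]: "sets \<rho> = sets borel" by fact
  interpret R: sigma_finite_measure \<rho> by (rule translation_bounded_sigma_finite[OF assms])
  interpret P: pair_sigma_finite lborel \<rho> ..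
  let ?K = "cbox 0 (One::'a)"
  let ?d = "3 ^ DIM('a) :: real"
  \<comment> \<open>The cube is reflected because the exchanged integral runs over \<open>y\<close>:
    \<open>s - y + k\<close> lies in the unit cube iff \<open>y\<close> lies in the reflected cube
    moved by \<open>s + k\<close>.\<close>
  have "compact (cbox (- One) (0::'a))" by simp
  then obtain C :: real where C: "\<And>t. emeasure \<rho> ((+) t ` cbox (- One) (0::'a)) \<le> ennreal C"
    using tb unfolding translation_bounded_def by blast
  have "(\<integral>\<^sup>+y. ennreal (cauchy_kernel (y - k)) \<partial>\<rho>)
      \<le> (\<integral>\<^sup>+y. \<integral>\<^sup>+s. ennreal ?d * (ennreal (cauchy_kernel s) * indicator ?K (s - y + k)) \<partial>lborel \<partial>\<rho>)"
  proof (rule nn_integral_mono)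
    fix y
    have "emeasure lborel ?K = 1" by simp
    then have "ennreal (cauchy_kernel (y - k)) = (\<integral>\<^sup>+t. ennreal (cauchy_kernel (y - k)) * indicator ?K t \<partial>lborel)"
      by (simp add: nn_integral_cmult_indicator)
    also have "\<dots> \<le> (\<integral>\<^sup>+t. ennreal ?d * (ennreal (cauchy_kernel (y - k + t)) * indicator ?K t) \<partial>lborel)"
      by (intro nn_integral_mono)
         (auto simp: indicator_def ennreal_mult[symmetric] cauchy_kernel_nonneg intro!: ennreal_leI cauchy_kernel_shift)
    \<comment> \<open>The integrand is put in terms of \<open>y - k + t\<close> alone, ready for the
      substitution s = y - k + t.\<close>
    also have "\<dots> = (\<integral>\<^sup>+t. ennreal ?d * (ennreal (cauchy_kernel (y - k + t)) * indicator ?K ((y - k + t) - y + k)) \<partial>lborel)"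
      by simp
    also have "\<dots> = (\<integral>\<^sup>+s. ennreal ?d * (ennreal (cauchy_kernel s) * indicator ?K (s - y + k)) \<partial>distr lborel borel ((+) (y - k)))"
      by (subst nn_integral_distr) measurable
    also have "\<dots> = (\<integral>\<^sup>+s. ennreal ?d * (ennreal (cauchy_kernel s) * indicator ?K (s - y + k)) \<partial>lborel)"
      by (simp add: lborel_distr_plus)
    finally show "ennreal (cauchy_kernel (y - k))
        \<le> (\<integral>\<^sup>+s. ennreal ?d * (ennreal (cauchy_kernel s) * indicator ?K (s - y + k)) \<partial>lborel)" .
  qed
  also have "\<dots> = (\<integral>\<^sup>+s. \<integral>\<^sup>+y. ennreal ?d * (ennreal (cauchy_kernel s) * indicator ?K (s - y + k)) \<partial>\<rho> \<partial>(lborel :: 'a measure))"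
    by (rule P.Fubini') measurable
  also have "\<dots> \<le> (\<integral>\<^sup>+s. ennreal ?d * (ennreal (cauchy_kernel s) * ennreal C) \<partial>(lborel :: 'a measure))"
  proof (rule nn_integral_mono)
    fix s
    have "indicator ?K (s - y + k) = (indicator ((+) (s + k) ` cbox (- One) 0) y :: ennreal)" for y
    proof -
      have "y \<in> (+) (s + k) ` cbox (- One) 0 \<longleftrightarrow> s - y + k \<in> ?K"
      proof
        assume "s - y + k \<in> ?K"
        then have "y - (s + k) \<in> cbox (- One) 0" 
          by (auto simp: mem_box inner_simps)
        then show "y \<in> (+) (s + k) ` cbox (- One) 0"
          by (intro image_eqI[of _ _ "y - (s + k)"]) auto
      qed (auto simp: mem_box inner_simps)
      then show ?thesis by (simp add: indicator_def)
    qed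
    moreover have "(+) (s + k) ` cbox (- One) (0::'a) \<in> sets \<rho>"
      unfolding sets by (intro borel_closed closed_translation) auto
    ultimately have "(\<integral>\<^sup>+y. ennreal ?d * (ennreal (cauchy_kernel s) * indicator ?K (s - y + k)) \<partial>\<rho>)
        = ennreal ?d * (ennreal (cauchy_kernel s) * emeasure \<rho> ((+) (s + k) ` cbox (- One) 0))"
      by (simp add: nn_integral_cmult)
    also have "\<dots> \<le> ennreal ?d * (ennreal (cauchy_kernel s) * ennreal C)"
      by (intro mult_left_mono C) auto
    finally show "(\<integral>\<^sup>+y. ennreal ?d * (ennreal (cauchy_kernel s) * indicator ?K (s - y + k)) \<partial>\<rho>)
        \<le> ennreal ?d * (ennreal (cauchy_kernel s) * ennreal C)" .
  qed
  also have "\<dots> = ennreal ?d * ((\<integral>\<^sup>+s. ennreal (cauchy_kernel (s::'a)) \<partial>lborel) * ennreal C)"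
    by (simp add: nn_integral_cmult nn_integral_multc)
  also have "(\<integral>\<^sup>+s. ennreal (cauchy_kernel (s::'a)) \<partial>lborel) =
      (\<integral>\<^sup>+s. (\<Prod>b\<in>Basis. ennreal (inverse (1 + (s \<bullet> b)^2))) \<partial>(lborel::'a measure))"
    by (simp add: cauchy_kernel_def prod_ennreal add_nonneg_nonneg)
  also have "\<dots> = (\<Prod>b\<in>(Basis::'a set). (\<integral>\<^sup>+x. ennreal (inverse (1 + x^2)) \<partial>(lborel :: real measure)))"
    by (rule nn_integral_lborel_prod) auto
  also have "ennreal ?d * (\<dots> * ennreal C) < \<infinity>"
    using nn_integral_inverse_1_plus_square_finite by (simp add: ennreal_mult_less_top power_less_top_ennreal)
  finally have "(\<integral>\<^sup>+y. ennreal (cauchy_kernel (y - k)) \<partial>\<rho>) < \<infinity>" .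
  then show ?thesis by (simp add: integrable_iff_bounded cauchy_kernel_nonneg)
qed

section \<open>Domination and L2 convergence of the transforms\<close>

lemma fourier_plateau_wave_bound:
  obtains C where "C \<ge> 0"
    "\<And>R (k::'a::euclidean_space) y. R \<ge> 1 \<Longrightarrow> (norm (fourier (plateau_wave k R) y))^2 \<le> C * cauchy_kernel (y - k)"
proof -
  obtain K where K: "K \<ge> 0" "\<And>R u. R \<ge> 1 \<Longrightarrow> \<bar>u\<bar> * norm (plateau_transform R u) \<le> K / R"
    using plateau_transform_decay by metis
  show ?thesis
  proof (rule that)
    fix R :: real and k y :: 'a assume R: "R \<ge> 1"
    have *: "(norm (plateau_transform R u))^2 \<le> (9 + K^2) * inverse (1 + u^2)" for u
    proof -
      let ?q = "norm (plateau_transform R u)"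
      have "\<bar>u\<bar> * ?q \<le> K / R" by (rule K(2)[OF R])
      also have "\<dots> \<le> K" using R K(1) by (simp add: field_simps mult_le_cancel_left1)
      finally have "(\<bar>u\<bar> * ?q)^2 \<le> K^2" by (intro power_mono) auto
      moreover have "?q^2 \<le> 3^2" by (intro power_mono plateau_transform_bound R) auto
      \<comment> \<open>The 9 is the square of the uniform bound 3 and controls small
        \<open>u\<close>; \<open>K^2\<close> comes from the decay and controls large
        \<open>u\<close>.\<close>
      ultimately have "?q^2 * (1 + u^2) \<le> 9 + K^2"
        by (simp add: power_mult_distrib algebra_simps)
      then show ?thesis by (simp add: field_simps add_pos_nonneg)
    qed
    have "(norm (fourier (plateau_wave k R) y))^2
        = (\<Prod>b\<in>Basis. (norm (plateau_transform R ((k - y) \<bullet> b)))^2)"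
      by (simp add: fourier_plateau_wave prod_power_distrib flip: prod_norm)
    also have "\<dots> \<le> (\<Prod>b\<in>(Basis::'a set). (9 + K^2) * inverse (1 + ((k - y) \<bullet> b)^2))"
      by (intro prod_mono conjI *) simp
    also have "\<dots> = (9 + K^2) ^ DIM('a) * cauchy_kernel (y - k)"
      by (simp add: prod.distrib cauchy_kernel_def inner_diff_left power2_commute)
    finally show "(norm (fourier (plateau_wave k R) y))^2 \<le> (9 + K^2) ^ DIM('a) * cauchy_kernel (y - k)" .
  qed simp
qed

lemma tendsto_plateau_transform:
  "((\<lambda>R. plateau_transform R u) \<longlongrightarrow> (if u = 0 then 1 else 0)) at_top"
proof (cases "u = 0")
  case True
  have "((\<lambda>R. plateau_transform R 0 - 1) \<longlongrightarrow> 0) at_top"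
  proof (rule Lim_null_comparison)
    show "\<forall>\<^sub>F R in at_top. norm (plateau_transform R 0 - 1) \<le> 2 / R"
      using eventually_ge_at_top[of 1] by eventually_elim (rule plateau_transform_0)
    show "((\<lambda>R::real. 2 / R) \<longlongrightarrow> 0) at_top"
      by (intro tendsto_divide_0[OF tendsto_const] filterlim_at_top_imp_at_infinity filterlim_ident)
  qed
  then show ?thesis using True by (simp add: LIM_zero_iff)
next
  case False
  obtain K where K: "K \<ge> 0" "\<And>R u. R \<ge> 1 \<Longrightarrow> \<bar>u\<bar> * norm (plateau_transform R u) \<le> K / R"
    using plateau_transform_decay by metis
  have "((\<lambda>R. plateau_transform R u) \<longlongrightarrow> 0) at_top"
  proof (rule Lim_null_comparison)
    show "\<forall>\<^sub>F R in at_top. norm (plateau_transform R u) \<le> (K / \<bar>u\<bar>) / R"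
      using eventually_ge_at_top[of 1]
    proof eventually_elim
      case (elim R)
      from K(2)[OF elim, of u] show ?case using False elim by (simp add: field_simps)
    qed
    show "((\<lambda>R::real. (K / \<bar>u\<bar>) / R) \<longlongrightarrow> 0) at_top"
      by (intro tendsto_divide_0[OF tendsto_const] filterlim_at_top_imp_at_infinity filterlim_ident)
  qed
  then show ?thesis using False by simp
qed

lemma tendsto_fourier_plateau_wave:
  "((\<lambda>R. fourier (plateau_wave k R) y) \<longlongrightarrow> indicator {k} y) at_top"
proof -
  have "((\<lambda>R. \<Prod>b\<in>Basis. plateau_transform R ((k - y) \<bullet> b))
      \<longlongrightarrow> (\<Prod>b\<in>Basis. if (k - y) \<bullet> b = 0 then 1 else 0)) at_top"
    by (intro tendsto_prod tendsto_plateau_transform)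
  also have "(\<Prod>b\<in>Basis. if (k - y) \<bullet> b = 0 then 1 else 0) = (indicator {k} y :: complex)"
  proof (cases "y = k")
    case False
    then obtain b where "b \<in> Basis" "(k - y) \<bullet> b \<noteq> 0"
      by (metis euclidean_all_zero_iff right_minus_eq)
    then show ?thesis using False by (auto intro!: prod_zero)
  qed simp
  finally show ?thesis unfolding fourier_plateau_wave .
qed

lemma measurable_fourier_plateau_wave [measurable]:
  "fourier (plateau_wave k R) \<in> borel_measurable borel"
  unfolding fourier_plateau_wave[abs_def] by measurable

lemma norm_diff_power2_le:
  fixes a b :: "'a::real_normed_vector"
  shows "(norm (a - b))^2 \<le> 2 * (norm a)^2 + 2 * (norm b)^2"
proof -
  have "(norm (a - b))^2 \<le> (norm a + norm b)^2"
    by (intro power_mono norm_triangle_ineq4) simp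
  also have "\<dots> \<le> 2 * (norm a)^2 + 2 * (norm b)^2"
    using zero_le_power2[of "norm a - norm b"] by (simp add: power2_eq_square algebra_simps)
  finally show ?thesis .
qed

text \<open>Dominated convergence with a multiple of the Cauchy kernel centred at \<open>k\<close>.
  The kernel equals 1 at its centre, so it also dominates the limit, the indicator of
  \<open>{k}\<close>.\<close>

lemma L2_fourier_plateau_wave:
  fixes \<rho> :: "'a::euclidean_space measure"
  assumes sets: "sets \<rho> = sets borel" and tb: "translation_bounded \<rho>"
  shows "R \<ge> 1 \<Longrightarrow> fourier (plateau_wave k R) \<in> L2 \<rho>"
    and "indicator {k} \<in> L2 \<rho>"
    and "((\<lambda>R. L2_norm \<rho> (\<lambda>y. fourier (plateau_wave k R) y - indicator {k} y)) \<longlongrightarrow> 0) at_top"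
proof -
  have [measurable_cong]: "sets \<rho> = sets borel" by fact
  obtain C where C: "C \<ge> 0"
    "\<And>R (k::'a) y. R \<ge> 1 \<Longrightarrow> (norm (fourier (plateau_wave k R) y))^2 \<le> C * cauchy_kernel (y - k)"
    using fourier_plateau_wave_bound by metis
  note int = integrable_cauchy_kernel[OF sets tb, of k]
  have ind: "(norm (indicator {k} y :: complex))^2 \<le> cauchy_kernel (y - k)" for y
    by (cases "y = k") (simp_all add: cauchy_kernel_nonneg, simp add: cauchy_kernel_def)
  show "fourier (plateau_wave k R) \<in> L2 \<rho>" if "R \<ge> 1" for R
    unfolding L2_def
  proof (intro CollectI conjI)
    show "integrable \<rho> (\<lambda>y. (norm (fourier (plateau_wave k R) y))^2)"
      by (rule Bochner_Integration.integrable_bound[OF integrable_mult_right[OF int, of C]])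
         (use C that in \<open>auto simp: abs_mult abs_of_nonneg[OF cauchy_kernel_nonneg]\<close>)
  qed measurable
  show "indicator {k} \<in> L2 \<rho>"
    unfolding L2_def
  proof (intro CollectI conjI)
    show "integrable \<rho> (\<lambda>y. (norm (indicator {k} y :: complex))^2)"
      by (rule Bochner_Integration.integrable_bound[OF int])
         (use ind in \<open>auto simp: abs_of_nonneg[OF cauchy_kernel_nonneg]\<close>)
  qed measurable
  have "((\<lambda>R. \<integral>y. (norm (fourier (plateau_wave k R) y - indicator {k} y))^2 \<partial>\<rho>)
      \<longlongrightarrow> (\<integral>y. 0 \<partial>\<rho>)) at_top"
  proof (rule integral_dominated_convergence_at_top)
    \<comment> \<open>From |a - b|^2 \<le> 2 |a|^2 + 2 |b|^2: the transform contributes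
      \<open>2 * C\<close> and the indicator 2.\<close>
    show "integrable \<rho> (\<lambda>y. (2 * C + 2) * cauchy_kernel (y - k))"
      by (intro integrable_mult_right int)
    have "((\<lambda>R. (norm (fourier (plateau_wave k R) y - indicator {k} y))^2)
       \<longlongrightarrow> (norm (indicator {k} y - indicator {k} y :: complex))^2) at_top" for y
      by (intro tendsto_intros tendsto_fourier_plateau_wave)
    then show "AE y in \<rho>. ((\<lambda>R. (norm (fourier (plateau_wave k R) y - indicator {k} y))^2) \<longlongrightarrow> 0) at_top"
      by simp
    show "\<forall>\<^sub>F R in at_top. AE y in \<rho>. norm ((norm (fourier (plateau_wave k R) y - indicator {k} y))^2)
        \<le> (2 * C + 2) * cauchy_kernel (y - k)"
      using eventually_ge_at_top[of 1]
    proof eventually_elim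
      case (elim R)
      have "(norm (fourier (plateau_wave k R) y - indicator {k} y))^2 \<le> (2 * C + 2) * cauchy_kernel (y - k)" for y
        using norm_diff_power2_le[of "fourier (plateau_wave k R) y" "indicator {k} y"]
          C(2)[OF elim, of k y] ind[of y] by (simp add: algebra_simps)
      then show ?case by simp
    qed
  qed measurable
  then show "((\<lambda>R. L2_norm \<rho> (\<lambda>y. fourier (plateau_wave k R) y - indicator {k} y)) \<longlongrightarrow> 0) at_top"
    unfolding L2_norm_def using tendsto_real_sqrt by fastforce
qed

lemma schwartz_plateau_wave: "plateau_wave k R \<in> schwartz"
  unfolding plateau_wave_def[abs_def]
proof (rule schwartz_prod[of _ "R / 2 + 1"])
  fix b :: 'a and n
  have "times_differentiable n (\<lambda>s. of_real (plateau R s) * (inverse (of_real R) * cis (2 * pi * (k \<bullet> b) * s)))"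
    by (intro times_differentiable_mult times_differentiable_of_real times_differentiable_plateau
        times_differentiable_const times_differentiable_cis)
  then show "times_differentiable n (\<lambda>s. complex_of_real (plateau R s / R) * cis (2 * pi * (k \<bullet> b) * s))"
    by (simp add: divide_inverse mult.assoc)
qed (simp add: plateau_eq_0)

subsection \<open>Integer-valued measures\<close>

definition locally_integer_valued :: "'a::euclidean_space measure \<Rightarrow> bool" where
  "locally_integer_valued M \<longleftrightarrow> sets M = sets borel \<and>
     (\<forall>A\<in>bounded_borel. \<exists>n::nat. emeasure M A = of_nat n)"

lemma locally_integer_valued_sing:
  assumes "locally_integer_valued M"
  shows "emeasure M {x} = 0 \<or> emeasure M {x} \<ge> 1"
proof -
  obtain n :: nat where "emeasure M {x} = of_nat n"
    using assms unfolding locally_integer_valued_def bounded_borel_def by fastforce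
  then show ?thesis by (cases n) auto
qed

lemma locally_integer_valued_sing_finite:
  assumes "locally_integer_valued M"
  shows "emeasure M {x} < \<infinity>"
proof -
  obtain n :: nat where "emeasure M {x} = of_nat n"
    using assms unfolding locally_integer_valued_def bounded_borel_def by fastforce
  then show ?thesis by (simp add: of_nat_less_top)
qed

text \<open>Every atom has mass at least 1, so a bounded set of mass n cannot contain n + 1 of
  them.\<close>

lemma finite_atoms:
  assumes M: "locally_integer_valued M" and A: "A \<in> bounded_borel"
  shows "finite {x \<in> A. emeasure M {x} \<noteq> 0}"
proof (rule ccontr)
  assume inf: "infinite {x \<in> A. emeasure M {x} \<noteq> 0}"
  have sets: "sets M = sets borel" using M by (simp add: locally_integer_valued_def)
  obtain n :: nat where n: "emeasure M A = of_nat n"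
    using M A unfolding locally_integer_valued_def by blast
  obtain F where F: "F \<subseteq> {x \<in> A. emeasure M {x} \<noteq> 0}" "card F = Suc n" "finite F"
    using infinite_arbitrarily_large[OF inf] by blast
  have "of_nat (Suc n) = (\<Sum>x\<in>F. 1 :: ennreal)" using F by simp
  also have "\<dots> \<le> (\<Sum>x\<in>F. emeasure M {x})"
    using F(1) locally_integer_valued_sing[OF M] by (intro sum_mono) blast
  also have "\<dots> = emeasure M F"
    using F(3) sets by (intro emeasure_eq_sum_singleton[symmetric]) auto
  also have "\<dots> \<le> of_nat n"
    unfolding n[symmetric] using F A sets by (intro emeasure_mono) (auto simp: bounded_borel_def)
  finally have "Suc n \<le> n" by (simp only: of_nat_le_iff)
  then show False by simp
qed

text \<open>Integrality forces null neighbourhoods around all points of the set, and by Lindelof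
  countably many of them cover it.\<close>

lemma emeasure_no_atoms:
  assumes M: "locally_integer_valued M" and A: "A \<in> bounded_borel"
    and no: "\<And>x. x \<in> A \<Longrightarrow> emeasure M {x} = 0"
  shows "emeasure M A = 0"
proof -
  have sets: "sets M = sets borel" using M by (simp add: locally_integer_valued_def)
  have bb: "B \<inter> A \<in> bounded_borel" if "B \<in> sets borel" for B
    using A that by (auto simp: bounded_borel_def intro: bounded_subset)
  have fin: "\<exists>n::nat. emeasure M B = of_nat n" if "B \<in> bounded_borel" for B
    using M that unfolding locally_integer_valued_def by blast
  \<comment> \<open>Small balls around a non-atom have mass below 1, hence mass 0.\<close>
  have null: "\<exists>U. open U \<and> x \<in> U \<and> emeasure M (U \<inter> A) = 0" if "x \<in> A" for x
  proof -
    let ?B = "\<lambda>n::nat. ball x (1 / real (Suc n)) \<inter> A"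
    have finB: "\<exists>m::nat. emeasure M (?B n) = of_nat m" for n
      by (rule fin[OF bb]) simp
    have "(INF n. emeasure M (?B n)) = emeasure M (\<Inter>n. ?B n)"
    proof (rule INF_emeasure_decseq)
      show "decseq ?B"
        by (intro antimonoI Int_mono subset_ball frac_le) auto
      show "emeasure M (?B n) \<noteq> \<infinity>" for n
        using finB[of n] by (metis infinity_ennreal_def ennreal_of_nat_neq_top)
      show "range ?B \<subseteq> sets M"
        unfolding sets using A by (intro image_subsetI sets.Int) (simp_all add: bounded_borel_def)
    qed
    also have "(\<Inter>n. ?B n) = {x}"
    proof -
      have "y = x" if "\<And>n. y \<in> ball x (1 / real (Suc n))" for y
      proof (rule ccontr)
        assume "y \<noteq> x"
        then obtain n where "1 / real (Suc n) < dist x y"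
          using reals_Archimedean[of "dist x y"] by (auto simp: inverse_eq_divide)
        with that[of n] show False by simp
      qed
      then show ?thesis using that by auto
    qed
    finally have "(INF n. emeasure M (?B n)) < 1" using no[OF that] by simp
    then obtain n where n: "emeasure M (?B n) < 1" by (auto simp: INF_less_iff)
    obtain m :: nat where "emeasure M (?B n) = of_nat m"
      using finB by blast
    with n have "emeasure M (?B n) = 0" by (cases m) auto
    then show ?thesis by (intro exI[of _ "ball x (1 / real (Suc n))"]) auto
  qed
  let ?F = "{U. open U \<and> emeasure M (U \<inter> A) = 0}"
  obtain F' where F': "F' \<subseteq> ?F" "countable F'" "\<Union>F' = \<Union>?F"
    using Lindelof[of ?F] by auto
  have "A \<subseteq> \<Union>?F" using null by blast
  then have "A = (\<Union>U\<in>F'. U \<inter> A)" using F'(3) by auto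
  moreover have "(\<Union>U\<in>F'. U \<inter> A) \<in> null_sets M"
    using F' A sets by (intro null_sets_UN') (auto simp: null_sets_def bounded_borel_def)
  ultimately show ?thesis by (simp add: null_sets_def)
qed

lemma AE_atoms:
  assumes M: "locally_integer_valued M" and A: "A \<in> bounded_borel"
  shows "AE x in M. x \<in> A \<longrightarrow> emeasure M {x} \<noteq> 0"
proof -
  have sets: "sets M = sets borel" using M by (simp add: locally_integer_valued_def)
  let ?F = "{x \<in> A. emeasure M {x} \<noteq> 0}"
  have "?F \<in> sets borel" using finite_atoms[OF M A] by (intro borel_closed finite_imp_closed)
  then have "A - ?F \<in> bounded_borel"
    using A by (auto simp: bounded_borel_def intro: bounded_subset)
  moreover from this have "emeasure M (A - ?F) = 0"
    by (rule emeasure_no_atoms[OF M]) auto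
  ultimately have "A - ?F \<in> null_sets M"
    using sets by (auto simp: null_sets_def bounded_borel_def)
  then have "AE x in M. x \<notin> A - ?F" by (rule AE_not_in)
  then show ?thesis by eventually_elim auto
qed

text \<open>Almost everywhere the integrand agrees with a finite sum of indicators of atoms. This is
  the bridge between sums over points, which occur in the averages, and integrals, which the vague
  topology controls.\<close>

lemma integral_atoms:
  fixes f :: "'a::euclidean_space \<Rightarrow> 'b::{banach, second_countable_topology}"
  assumes M: "locally_integer_valued M" and A: "A \<in> bounded_borel" and f: "f \<in> borel_measurable borel"
  shows "integrable M (\<lambda>x. indicator A x *\<^sub>R f x)"
    and "(\<integral>x. indicator A x *\<^sub>R f x \<partial>M) = (\<Sum>x | x \<in> A \<and> emeasure M {x} \<noteq> 0. measure M {x} *\<^sub>R f x)"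
proof -
  have sets: "sets M = sets borel" using M by (simp add: locally_integer_valued_def)
  have [measurable_cong]: "sets M = sets borel" by fact
  have [measurable]: "A \<in> sets borel" "f \<in> borel_measurable borel" using A f by (auto simp: bounded_borel_def)
  let ?F = "{x \<in> A. emeasure M {x} \<noteq> 0}"
  note fin = locally_integer_valued_sing_finite[OF M]
  have AE: "AE x in M. indicator A x *\<^sub>R f x = (\<Sum>p\<in>?F. indicator {p} x *\<^sub>R f p)"
    using AE_atoms[OF M A]
  proof eventually_elim
    case (elim x)
    have "(\<Sum>p\<in>?F. indicator {p} x *\<^sub>R f p) = (\<Sum>p\<in>?F. if p = x then f x else 0)"
      by (intro sum.cong) (auto simp: indicator_def)
    also have "\<dots> = indicator A x *\<^sub>R f x"
      using elim finite_atoms[OF M A] by (auto simp: indicator_def)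
    finally show ?case by simp
  qed
  have hb: "has_bochner_integral M (\<lambda>x. \<Sum>p\<in>?F. indicator {p} x *\<^sub>R f p) (\<Sum>p\<in>?F. measure M {p} *\<^sub>R f p)"
    by (intro has_bochner_integral_sum has_bochner_integral_scaleR_left has_bochner_integral_real_indicator fin)
       (simp add: sets)
  have "has_bochner_integral M (\<lambda>x. indicator A x *\<^sub>R f x) (\<Sum>p\<in>?F. measure M {p} *\<^sub>R f p)"
    using hb by (subst has_bochner_integral_cong_AE[OF _ _ AE]) measurable
  then show "integrable M (\<lambda>x. indicator A x *\<^sub>R f x)"
    and "(\<integral>x. indicator A x *\<^sub>R f x \<partial>M) = (\<Sum>x | x \<in> A \<and> emeasure M {x} \<noteq> 0. measure M {x} *\<^sub>R f x)"
    by (auto simp: has_bochner_integral_iff)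
qed

section \<open>Colour parts as pushforwards of slices\<close>

lemma measurable_fst_snd_borel:
  "(fst :: 'a::topological_space \<times> 'b::topological_space \<Rightarrow> 'a) \<in> borel_measurable borel"
  "(snd :: 'a \<times> 'b \<Rightarrow> 'b) \<in> borel_measurable borel"
  by (intro borel_measurable_continuous_onI continuous_intros)+

lemma Times_sing_borel:
  fixes i :: "'m::discrete_topology"
  assumes "A \<in> sets (borel :: 'a::topological_space measure)"
  shows "A \<times> {i} \<in> sets (borel :: ('a \<times> 'm) measure)"
proof -
  have "fst -` A \<inter> snd -` {i} \<in> sets (borel :: ('a \<times> 'm) measure)"
    using measurable_sets[OF measurable_fst_snd_borel(1) assms]
      measurable_sets[OF measurable_fst_snd_borel(2), of "{i}"] discrete_topology_class.open_discrete[of "{i}"]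
    by (auto intro!: sets.Int)
  also have "fst -` A \<inter> snd -` {i} = A \<times> {i}" by auto
  finally show ?thesis .
qed

lemma emeasure_distr_slice:
  fixes L :: "('a::euclidean_space \<times> 'm::{finite,discrete_topology}) measure"
  assumes sets: "sets L = sets borel" and A: "A \<in> sets borel"
  shows "emeasure (distr (density L (indicator (UNIV \<times> {i}))) borel fst) A = emeasure L (A \<times> {i})"
proof -
  have meas: "fst \<in> measurable (density L (indicator (UNIV \<times> {i}))) borel"
    using measurable_fst_snd_borel(1)[where 'a='a and 'b='m] sets
    by (simp cong: measurable_cong_sets)
  have pre: "fst -` A \<in> sets L"
    using measurable_sets[OF measurable_fst_snd_borel(1) A] by (simp add: sets)
  have Ti: "UNIV \<times> {i} \<in> sets L" unfolding sets by (rule Times_sing_borel) simp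
  have "emeasure (distr (density L (indicator (UNIV \<times> {i}))) borel fst) A
      = emeasure (density L (indicator (UNIV \<times> {i}))) (fst -` A)"
    using A meas sets_eq_imp_space_eq[OF sets] by (subst emeasure_distr) auto
  also have "\<dots> = emeasure L ((UNIV \<times> {i}) \<inter> fst -` A)"
    using pre Ti by (subst emeasure_density) (auto simp flip: indicator_inter_arith)
  also have "(UNIV \<times> {i}) \<inter> fst -` A = A \<times> {i}" by auto
  finally show ?thesis .
qed

text \<open>\<open>measure_of\<close> falls back to the zero measure when its set function is not a
  measure. Writing the colour part as the pushforward of a restricted measure shows that this does
  not happen and that its values are the intended ones.\<close>

lemma colour_part_eq_distr:
  fixes L :: "('a::euclidean_space \<times> 'm::{finite,discrete_topology}) measure"
  assumes sets: "sets L = sets borel"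
  shows "colour_part L i = distr (density L (indicator (UNIV \<times> {i}))) borel fst" (is "_ = ?N")
proof -
  have "colour_part L i = measure_of (space ?N) (sets ?N) (emeasure ?N)"
    unfolding colour_part_def space_distr sets_distr space_borel
    by (rule measure_of_eq)
       (auto simp: emeasure_distr_slice[OF sets] sets.sigma_sets_eq[of borel, simplified])
  also have "\<dots> = ?N" by (rule measure_of_of_measure)
  finally show ?thesis .
qed

lemma sets_colour_part [simp, measurable_cong]: "sets (colour_part L i) = sets borel"
  unfolding colour_part_def using sets.sigma_sets_eq[of borel] by (simp add: sets_measure_of)

lemma emeasure_colour_part:
  fixes L :: "('a::euclidean_space \<times> 'm::{finite,discrete_topology}) measure"
  assumes "sets L = sets borel" "A \<in> sets borel"
  shows "emeasure (colour_part L i) A = emeasure L (A \<times> {i})"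
  unfolding colour_part_eq_distr[OF assms(1)] by (rule emeasure_distr_slice[OF assms])

lemma integral_colour_part:
  fixes L :: "('a::euclidean_space \<times> 'm::{finite,discrete_topology}) measure" and f :: "'a \<Rightarrow> real"
  assumes sets: "sets L = sets borel" and f: "f \<in> borel_measurable borel"
  shows "(\<integral>x. f x \<partial>colour_part L i) = (\<integral>z. indicator {i} (snd z) * f (fst z) \<partial>L)"
proof -
  have Ti: "UNIV \<times> {i} \<in> sets L" unfolding sets by (rule Times_sing_borel) simp
  have meas: "fst \<in> measurable L borel"
    using measurable_fst_snd_borel(1)[where 'a='a and 'b='m] sets
    by (simp cong: measurable_cong_sets)
  have "(\<integral>x. f x \<partial>colour_part L i) = (\<integral>z. f (fst z) \<partial>density L (\<lambda>z. ennreal (indicator (UNIV \<times> {i}) z)))"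
    unfolding colour_part_eq_distr[OF sets] ennreal_indicator
    using meas f by (subst integral_distr) auto
  also have "\<dots> = (\<integral>z. indicator (UNIV \<times> {i}) z *\<^sub>R f (fst z) \<partial>L)"
    using Ti meas f by (intro integral_density) auto
  also have "\<dots> = (\<integral>z. indicator {i} (snd z) * f (fst z) \<partial>L)"
    by (intro Bochner_Integration.integral_cong) (auto simp: indicator_def)
  finally show ?thesis .
qed

lemma locally_integer_valued_colour_part:
  fixes L :: "('a::euclidean_space \<times> 'm::{finite,discrete_topology}) measure"
  assumes "L \<in> Mp"
  shows "locally_integer_valued (colour_part L i)"
  unfolding locally_integer_valued_def
proof (intro conjI ballI)
  fix A :: "'a set" assume A: "A \<in> bounded_borel"
  then have "compact (closure (A \<times> {i}))"
    by (simp add: closure_Times compact_Times bounded_borel_def)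
  with A assms obtain n :: nat where "emeasure L (A \<times> {i}) = of_nat n"
    using Times_sing_borel[of A i] by (auto simp: Mp_def bounded_borel_def)
  with A assms show "\<exists>n::nat. emeasure (colour_part L i) A = of_nat n"
    by (auto simp: emeasure_colour_part Mp_def bounded_borel_def)
qed simp

section \<open>Cubes, sums over points and the boundary shell\<close>

lemma mem_cube: "x \<in> cube R \<longleftrightarrow> (\<forall>b\<in>Basis. \<bar>x \<bullet> b\<bar> < R / 2)"
  unfolding cube_def by (force simp: mem_box abs_less_iff)

lemma cube_mono: "R \<le> R' \<Longrightarrow> cube R \<subseteq> cube R'"
  using less_le_trans[OF _ divide_right_mono[of R R' 2]] by (fastforce simp: mem_cube)

lemma cube_bounded_borel: "cube R \<in> bounded_borel"
  by (simp add: cube_def bounded_borel_def bounded_box)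

lemma measure_cube: "R \<ge> 0 \<Longrightarrow> measure lborel (cube R :: 'a::euclidean_space set) = R ^ DIM('a)"
proof -
  assume R: "R \<ge> 0"
  then have "emeasure lborel (cube R :: 'a set) = ennreal (\<Prod>b\<in>(Basis::'a set). R)"
    unfolding cube_def by (subst emeasure_lborel_box) (auto simp: inner_simps intro!: arg_cong[where f=ennreal] prod.cong)
  then show ?thesis using R by (simp add: measure_def)
qed

lemma mem_translate_cube: "a \<in> (+) x ` cube r \<longleftrightarrow> x \<in> (+) a ` cube r"
proof -
  have "a \<in> (+) x ` cube r" if "x \<in> (+) a ` cube r" for a x :: 'a
    using that by (intro image_eqI[of _ _ "a - x"]) (auto simp: mem_cube)
  then show ?thesis by blast
qed

lemma Mp_cubeD:
  assumes "L \<in> Mp_cube r"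
  shows "L \<in> Mp" "sets L = sets borel"
  using assms by (auto simp: Mp_cube_def Mp_def)

lemma finite_wmeasure_support:
  assumes L: "L \<in> Mp" and A: "A \<in> bounded_borel"
  shows "finite {x \<in> A. wmeasure w L {x} \<noteq> 0}"
proof (rule finite_subset)
  show "{x \<in> A. wmeasure w L {x} \<noteq> 0} \<subseteq> (\<Union>i. {x \<in> A. emeasure (colour_part L i) {x} \<noteq> 0})"
    by (auto simp: wmeasure_def measure_def intro!: sum.neutral)
qed (intro finite_UN_I finite_atoms[OF locally_integer_valued_colour_part[OF L] A] finite)

text \<open>\<open>infsum\<close> is 0 when the family is not summable. A bounded set has only
  finitely many contributing points, so no such default is involved.\<close>

lemma infsum_wmeasure_eq_sum:
  assumes L: "L \<in> Mp" and A: "A \<in> bounded_borel"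
  shows "(\<Sum>\<^sub>\<infinity>x\<in>A. of_real (wmeasure w L {x}) * f x)
    = (\<Sum>x | x \<in> A \<and> wmeasure w L {x} \<noteq> 0. complex_of_real (wmeasure w L {x}) * f x)"
proof -
  have "(\<Sum>\<^sub>\<infinity>x\<in>A. of_real (wmeasure w L {x}) * f x)
    = (\<Sum>\<^sub>\<infinity>x\<in>{x \<in> A. wmeasure w L {x} \<noteq> 0}. complex_of_real (wmeasure w L {x}) * f x)"
    by (rule infsum_cong_neutral) auto
  also have "\<dots> = (\<Sum>x | x \<in> A \<and> wmeasure w L {x} \<noteq> 0. complex_of_real (wmeasure w L {x}) * f x)"
    using finite_wmeasure_support[OF L A] by simp
  finally show ?thesis .
qed

lemma infsum_wmeasure_eq_integral:
  fixes w :: "real ^ 'm::{finite,discrete_topology}"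
  assumes L: "L \<in> Mp" and A: "A \<in> bounded_borel" and f: "f \<in> borel_measurable borel"
  shows "(\<Sum>\<^sub>\<infinity>x\<in>A. complex_of_real (wmeasure w L {x}) * f x)
    = (\<Sum>i\<in>UNIV. of_real (w $ i) * (\<integral>x. indicator A x *\<^sub>R f x \<partial>colour_part L i))"
proof -
  note liv = locally_integer_valued_colour_part[OF L]
  \<comment> \<open>The atoms of all colours are collected, not just the points with nonzero
    \<open>wmeasure\<close>: weights may cancel at a point, yet each colour needs all of its own
    atoms once the sums are exchanged.\<close>
  let ?F = "\<Union>i. {x \<in> A. emeasure (colour_part L i) {x} \<noteq> 0}"
  have fin: "finite ?F"
    by (intro finite_UN_I finite_atoms[OF liv A] finite)
  have "(\<Sum>\<^sub>\<infinity>x\<in>A. complex_of_real (wmeasure w L {x}) * f x)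
      = (\<Sum>\<^sub>\<infinity>x\<in>?F. complex_of_real (wmeasure w L {x}) * f x)"
    by (rule infsum_cong_neutral) (auto simp: wmeasure_def measure_def)
  also have "\<dots> = (\<Sum>x\<in>?F. complex_of_real (wmeasure w L {x}) * f x)"
    using fin by simp
  also have "\<dots> = (\<Sum>x\<in>?F. \<Sum>i\<in>UNIV. of_real (w $ i) * (measure (colour_part L i) {x} *\<^sub>R f x))"
    by (simp add: wmeasure_def sum_distrib_right scaleR_conv_of_real mult.assoc)
  also have "\<dots> = (\<Sum>i\<in>UNIV. \<Sum>x\<in>?F. of_real (w $ i) * (measure (colour_part L i) {x} *\<^sub>R f x))"
    by (rule sum.swap)
  also have "\<dots> = (\<Sum>i\<in>UNIV. of_real (w $ i) * (\<integral>x. indicator A x *\<^sub>R f x \<partial>colour_part L i))"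
  proof (intro sum.cong refl)
    fix i
    have "(\<Sum>x\<in>?F. of_real (w $ i) * (measure (colour_part L i) {x} *\<^sub>R f x))
      = (\<Sum>x | x \<in> A \<and> emeasure (colour_part L i) {x} \<noteq> 0. of_real (w $ i) * (measure (colour_part L i) {x} *\<^sub>R f x))"
      using fin by (intro sum.mono_neutral_right) (auto simp: measure_def)
    then show "(\<Sum>x\<in>?F. of_real (w $ i) * (measure (colour_part L i) {x} *\<^sub>R f x))
        = of_real (w $ i) * (\<integral>x. indicator A x *\<^sub>R f x \<partial>colour_part L i)"
      by (simp add: integral_atoms(2)[OF liv A f] sum_distrib_left)
  qed
  finally show ?thesis .
qed

text \<open>
  A point \<open>a\<close> lies in the cube centred at \<open>x\<close> iff \<open>x\<close> lies in the cube centred at \<open>a\<close>, which carries mass at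
  most 1. Hence the cubes centred at the points of one colour are disjoint.
\<close>

lemma sum_colour_part_le_volume:
  fixes L :: "('a::euclidean_space \<times> 'm::{finite,discrete_topology}) measure"
  assumes L: "L \<in> Mp_cube r" and r: "r > 0" and F: "finite F"
    and T: "T \<in> bounded_borel" and sub: "\<And>x. x \<in> F \<Longrightarrow> (+) x ` cube r \<subseteq> T"
  shows "(\<Sum>x\<in>F. measure (colour_part L i) {x}) * r ^ DIM('a) \<le> measure lborel T"
proof -
  let ?M = "colour_part L i"
  have fin: "emeasure ?M {x} \<noteq> \<infinity>" for x
    using locally_integer_valued_sing_finite
      [OF locally_integer_valued_colour_part[OF Mp_cubeD(1)[OF L]], of i x] by simp
  have meas: "(+) x ` cube r \<in> sets (borel :: 'a measure)" for x
    by (intro borel_open open_translation) (simp add: cube_def open_box)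
  have vol: "measure lborel ((+) x ` cube r) = r ^ DIM('a)" for x :: 'a
  proof -
    have "emeasure lborel ((+) x ` cube r) = emeasure (distr lborel borel ((+) x)) ((+) x ` cube r)"
      by (simp add: lborel_distr_plus)
    also have "\<dots> = emeasure lborel (cube r :: 'a set)"
      using meas by (subst emeasure_distr) (auto simp: inj_vimage_image_eq)
    finally show ?thesis using measure_cube[of r, where 'a='a] r by (simp add: measure_def)
  qed
  \<comment> \<open>The overlap of the translated cubes at a single point \<open>a\<close>, counted
    with multiplicity.\<close>
  have le1: "(\<Sum>x\<in>{x\<in>F. a \<in> (+) x ` cube r}. measure ?M {x}) \<le> 1" for a
  proof -
    let ?G = "{x\<in>F. a \<in> (+) x ` cube r}"
    have UM: "(((+) a ` cube r) \<times> (UNIV :: 'm set)) \<in> sets L"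
    proof -
      have "(((+) a ` cube r) \<times> (UNIV :: 'm set)) = (\<Union>j. ((+) a ` cube r) \<times> {j})" by auto
      also have "\<dots> \<in> sets borel"
        by (intro sets.finite_UN finite Times_sing_borel meas)
      finally show ?thesis by (simp add: Mp_cubeD(2)[OF L])
    qed
    have "emeasure ?M ?G \<le> emeasure ?M ((+) a ` cube r)"
    proof (rule emeasure_mono)
      show "?G \<subseteq> (+) a ` cube r" using mem_translate_cube by blast
    qed (use meas in simp)
    also have "\<dots> = emeasure L (((+) a ` cube r) \<times> {i})"
      by (rule emeasure_colour_part[OF Mp_cubeD(2)[OF L] meas])
    also have "\<dots> \<le> emeasure L (((+) a ` cube r) \<times> UNIV)"
      using UM by (intro emeasure_mono) auto
    also have "\<dots> \<le> 1" using L by (simp add: Mp_cube_def)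
    finally have "emeasure ?M ?G \<le> 1" .
    then have "measure ?M ?G \<le> 1" unfolding measure_def
      by (metis enn2real_leI ennreal_1 zero_le_one)
    moreover have "measure ?M ?G = (\<Sum>x\<in>?G. measure ?M {x})"
      using F fin by (intro measure_eq_sum_singleton) auto
    ultimately show ?thesis by simp
  qed
  have finvol: "emeasure lborel ((+) x ` cube r) < \<infinity>" for x :: 'a
    using cube_bounded_borel[of r]
    by (intro emeasure_bounded_finite bounded_translation) (auto simp: bounded_borel_def)
  \<comment> \<open>The factor \<open>r ^ DIM('a)\<close> is the volume of each cube, so the left
    side is the integral of the overlap count, which lies below the indicator of
    \<open>T\<close>.\<close>
  have "(\<Sum>x\<in>F. measure ?M {x}) * r ^ DIM('a)
      = (\<Sum>x\<in>F. \<integral>a. measure ?M {x} * indicator ((+) x ` cube r) a \<partial>lborel)"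
    using vol meas by (simp add: sum_distrib_right)
  also have "\<dots> = (\<integral>a. (\<Sum>x\<in>F. measure ?M {x} * indicator ((+) x ` cube r) a) \<partial>lborel)"
    using meas finvol
    by (intro Bochner_Integration.integral_sum[symmetric] integrable_mult_right integrable_real_indicator) auto
  also have "\<dots> \<le> (\<integral>a. indicator T a \<partial>lborel)"
  proof (rule integral_mono)
    show "integrable lborel (\<lambda>a. \<Sum>x\<in>F. measure ?M {x} * indicator ((+) x ` cube r) a)"
      using meas finvol
      by (intro Bochner_Integration.integrable_sum integrable_mult_right integrable_real_indicator) auto
    show "integrable lborel (indicator T :: 'a \<Rightarrow> real)"
      using T by (intro integrable_real_indicator emeasure_bounded_finite) (auto simp: bounded_borel_def)
    fix a
    have "(\<Sum>x\<in>F. measure ?M {x} * indicator ((+) x ` cube r) a)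
        = (\<Sum>x\<in>{x\<in>F. a \<in> (+) x ` cube r}. measure ?M {x})"
      using F by (intro sum.mono_neutral_cong_right) (auto simp: indicator_def)
    also have "\<dots> \<le> indicator T a"
    proof (cases "a \<in> T")
      case False
      then have "{x\<in>F. a \<in> (+) x ` cube r} = {}" using sub by blast
      then show ?thesis by (simp only: sum.empty) simp
    qed (use le1 in simp)
    finally show "(\<Sum>x\<in>F. measure ?M {x} * indicator ((+) x ` cube r) a) \<le> indicator T a" .
  qed
  also have "\<dots> = measure lborel T" by simp
  finally show ?thesis .
qed

lemma plateau_wave_eq:
  "plateau_wave (k::'a::euclidean_space) R x
    = of_real (\<Prod>b\<in>Basis. plateau R (x \<bullet> b)) / of_real (R ^ DIM('a)) * cis (2 * pi * (k \<bullet> x))"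
proof -
  have "cis (2 * pi * (k \<bullet> x)) = (\<Prod>b\<in>Basis. cis (2 * pi * (k \<bullet> b) * (x \<bullet> b)))"
    by (subst euclidean_inner) (simp add: sum_distrib_left cis_sum mult.assoc)
  then show ?thesis
    by (simp add: plateau_wave_def prod.distrib prod_dividef)
qed

text \<open>Both sums agree on \<open>cube R\<close>. Each remaining point lies in the shell of ramp
  width 1 and contributes at most its absolute weight times R^-d; enlarging the shell by r/2 on both
  sides makes room for the cubes of edge \<open>r\<close> around the points. The bound does not
  depend on the configuration, so it passes to the L2 norm.\<close>

lemma counting_fun_minus_weighted_average_le:
  fixes w :: "real ^ 'm::{finite,discrete_topology}" and L :: "('a::euclidean_space \<times> 'm) measure"
  assumes L: "L \<in> Mp_cube r" and r: "r > 0" and R: "R \<ge> 1" "R \<ge> r"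
  shows "norm (counting_fun w (plateau_wave k R) L - weighted_average w k R L)
    \<le> (\<Sum>i\<in>UNIV. \<bar>w $ i\<bar>) * (((R + 2 + r) ^ DIM('a) - (R - r) ^ DIM('a)) / (r ^ DIM('a) * R ^ DIM('a)))"
proof -
  note Mp = Mp_cubeD(1)[OF L]
  let ?d = "DIM('a)"
  let ?c = "\<lambda>x. complex_of_real (wmeasure w L {x})"
  let ?F = "{x \<in> cube (R + 2). wmeasure w L {x} \<noteq> 0}"
  have finF: "finite ?F" by (rule finite_wmeasure_support[OF Mp cube_bounded_borel])
  have sub: "cube R \<subseteq> cube (R + 2)" by (rule cube_mono) simp
  have out: "plateau_wave k R x = 0" if "x \<notin> cube (R + 2)" for x :: 'a
  proof -
    obtain b where b: "b \<in> Basis" "\<bar>x \<bullet> b\<bar> \<ge> R / 2 + 1"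
      using \<open>x \<notin> cube (R + 2)\<close> by (auto simp: mem_cube not_less add_divide_distrib)
    then have "(\<Prod>b\<in>Basis. plateau R (x \<bullet> b)) = 0"
      using plateau_eq_0 by (intro prod_zero) auto
    then show ?thesis by (simp add: plateau_wave_eq)
  qed
  have "counting_fun w (plateau_wave k R) L = (\<Sum>\<^sub>\<infinity>x\<in>cube (R + 2). ?c x * plateau_wave k R x)"
    unfolding counting_fun_def using out by (intro infsum_cong_neutral) auto
  then have c: "counting_fun w (plateau_wave k R) L = (\<Sum>x\<in>?F. ?c x * plateau_wave k R x)"
    by (simp add: infsum_wmeasure_eq_sum[OF Mp cube_bounded_borel])
  have "weighted_average w k R L
      = (\<Sum>x | x \<in> cube R \<and> wmeasure w L {x} \<noteq> 0. ?c x * cis (2 * pi * (k \<bullet> x))) / of_real (R ^ ?d)"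
    using R by (simp add: weighted_average_def infsum_wmeasure_eq_sum[OF Mp cube_bounded_borel] measure_cube)
  also have "\<dots> = (\<Sum>x | x \<in> cube R \<and> wmeasure w L {x} \<noteq> 0. ?c x * plateau_wave k R x)"
    unfolding sum_divide_distrib
  proof (intro sum.cong refl)
    fix x assume "x \<in> {x. x \<in> cube R \<and> wmeasure w L {x} \<noteq> 0}"
    then have "(\<Prod>b\<in>Basis. plateau R (x \<bullet> b)) = 1"
      by (intro prod.neutral ballI plateau_eq_1) (auto simp: mem_cube less_imp_le)
    then show "?c x * cis (2 * pi * (k \<bullet> x)) / of_real (R ^ ?d) = ?c x * plateau_wave k R x"
      by (simp add: plateau_wave_eq)
  qed
  finally have a: "weighted_average w k R L
      = (\<Sum>x | x \<in> cube R \<and> wmeasure w L {x} \<noteq> 0. ?c x * plateau_wave k R x)" .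
  have "counting_fun w (plateau_wave k R) L - weighted_average w k R L
      = (\<Sum>x\<in>?F - cube R. ?c x * plateau_wave k R x)"
    unfolding c a
    by (subst sum.subset_diff[OF _ finF, of "{x. x \<in> cube R \<and> wmeasure w L {x} \<noteq> 0}"])
       (use sub in \<open>auto intro!: sum.cong\<close>)
  also have "norm \<dots> \<le> (\<Sum>x\<in>?F - cube R. norm (?c x * plateau_wave k R x))"
    by (rule norm_sum)
  also have "\<dots> \<le> (\<Sum>x\<in>?F - cube R. (\<Sum>i\<in>UNIV. \<bar>w $ i\<bar> * measure (colour_part L i) {x}) * (1 / R ^ ?d))"
  proof (rule sum_mono)
    fix x
    have "norm (plateau_wave k R x) = (\<Prod>b\<in>Basis. plateau R (x \<bullet> b)) / R ^ ?d"
      using R plateau_bounds(1)[of R]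
      by (simp add: plateau_wave_eq norm_mult norm_divide norm_power prod_nonneg flip: of_real_prod)
    also have "\<dots> \<le> 1 / R ^ ?d"
      using R plateau_bounds[of R] by (intro divide_right_mono prod_le_1) auto
    finally have 1: "norm (plateau_wave k R x) \<le> 1 / R ^ ?d" .
    have 2: "\<bar>wmeasure w L {x}\<bar> \<le> (\<Sum>i\<in>UNIV. \<bar>w $ i\<bar> * measure (colour_part L i) {x})"
      unfolding wmeasure_def by (rule order_trans[OF sum_abs]) (simp add: abs_mult)
    show "norm (?c x * plateau_wave k R x)
        \<le> (\<Sum>i\<in>UNIV. \<bar>w $ i\<bar> * measure (colour_part L i) {x}) * (1 / R ^ ?d)"
      unfolding norm_mult norm_of_real using 1 2 by (intro mult_mono) (auto intro!: sum_nonneg)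
  qed
  also have "\<dots> = (\<Sum>i\<in>UNIV. \<bar>w $ i\<bar> * (\<Sum>x\<in>?F - cube R. measure (colour_part L i) {x})) / R ^ ?d"
    unfolding sum_distrib_right[symmetric] by (subst sum.swap) (simp add: sum_distrib_left)
  also have "\<dots> \<le> (\<Sum>i\<in>UNIV. \<bar>w $ i\<bar> * (((R + 2 + r) ^ ?d - (R - r) ^ ?d) / r ^ ?d)) / R ^ ?d"
  proof (intro divide_right_mono sum_mono mult_left_mono)
    fix i
    \<comment> \<open>Moving by less than r/2 in each coordinate changes the edge length by
      \<open>r\<close>, outwards from \<open>R + 2\<close> and inwards from \<open>R\<close>. The
      assumption that \<open>R\<close> is at least \<open>r\<close> makes the inner volume
      \<open>(R - r) ^ ?d\<close>.\<close>
    let ?T = "cube (R + 2 + r) - cube (R - r) :: 'a set"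
    have "(\<Sum>x\<in>?F - cube R. measure (colour_part L i) {x}) * r ^ ?d \<le> measure lborel ?T"
    proof (rule sum_colour_part_le_volume[OF L r])
      show "?T \<in> bounded_borel"
        using cube_bounded_borel[of "R + 2 + r"] cube_bounded_borel[of "R - r"]
        by (auto simp: bounded_borel_def intro: bounded_subset)
      fix x assume x: "x \<in> ?F - cube R"
      show "(+) x ` cube r \<subseteq> ?T"
      proof
        fix y assume "y \<in> (+) x ` cube r"
        then have y: "\<bar>(y - x) \<bullet> b\<bar> < r / 2" if "b \<in> Basis" for b
          using that by (auto simp: mem_cube)
        have "y \<in> cube (R + 2 + r)"
          unfolding mem_cube
        proof
          fix b :: 'a assume b: "b \<in> Basis"
          have "\<bar>x \<bullet> b\<bar> < (R + 2) / 2" using x b by (auto simp: mem_cube)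
          with y[OF b] show "\<bar>y \<bullet> b\<bar> < (R + 2 + r) / 2"
            by (simp add: inner_diff_left) argo
        qed
        moreover obtain b where b: "b \<in> Basis" "\<bar>x \<bullet> b\<bar> \<ge> R / 2"
          using x by (auto simp: mem_cube not_less)
        then have "\<bar>y \<bullet> b\<bar> \<ge> (R - r) / 2"
          using y[OF b(1)] by (simp add: inner_diff_left) argo
        with b have "y \<notin> cube (R - r)" by (auto simp: mem_cube not_less)
        ultimately show "y \<in> ?T" by simp
      qed
    qed (use finF in simp)
    also have "measure lborel ?T = (R + 2 + r) ^ ?d - (R - r) ^ ?d"
    proof -
      have "measure lborel ?T = measure lborel (cube (R + 2 + r) :: 'a set) - measure lborel (cube (R - r) :: 'a set)"
      proof (rule measure_Diff)
        show "emeasure lborel (cube (R + 2 + r) :: 'a set) \<noteq> \<infinity>"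
          using cube_bounded_borel[of "R + 2 + r", where 'a='a]
          by (auto simp: bounded_borel_def dest!: emeasure_bounded_finite)
        show "cube (R - r) \<subseteq> (cube (R + 2 + r) :: 'a set)"
          using r by (intro cube_mono) simp
      qed (use cube_bounded_borel[of "R + 2 + r", where 'a='a] cube_bounded_borel[of "R - r", where 'a='a]
           in \<open>auto simp: bounded_borel_def\<close>)
      then show ?thesis using R r by (simp add: measure_cube)
    qed
    finally show "(\<Sum>x\<in>?F - cube R. measure (colour_part L i) {x}) \<le> ((R + 2 + r) ^ ?d - (R - r) ^ ?d) / r ^ ?d"
      using r by (simp add: pos_le_divide_eq)
  qed (use R in auto)
  also have "\<dots> = (\<Sum>i\<in>UNIV. \<bar>w $ i\<bar>) * (((R + 2 + r) ^ ?d - (R - r) ^ ?d) / (r ^ ?d * R ^ ?d))"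
    unfolding sum_distrib_right[symmetric] by simp
  finally show ?thesis .
qed

text \<open>After division by R^d both powers tend to 1 and cancel.\<close>

lemma tendsto_shell_volume:
  fixes r :: real
  assumes "r > 0"
  shows "((\<lambda>R. c * (((R + 2 + r) ^ d - (R - r) ^ d) / (r ^ d * R ^ d))) \<longlongrightarrow> 0) at_top"
proof -
  have inv: "((\<lambda>R::real. a / R) \<longlongrightarrow> 0) at_top" for a
    by (intro tendsto_divide_0[OF tendsto_const] filterlim_at_top_imp_at_infinity filterlim_ident)
  have "((\<lambda>R. c * (((1 + (2 + r) / R) ^ d - (1 - r / R) ^ d) / r ^ d))
      \<longlongrightarrow> c * (((1 + 0) ^ d - (1 - 0) ^ d) / r ^ d)) at_top"
    using assms by (intro tendsto_mult tendsto_divide[OF _ tendsto_const] tendsto_diff tendsto_power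
        tendsto_add tendsto_const inv) auto
  moreover have "\<forall>\<^sub>F R in at_top. c * (((1 + (2 + r) / R) ^ d - (1 - r / R) ^ d) / r ^ d)
      = c * (((R + 2 + r) ^ d - (R - r) ^ d) / (r ^ d * R ^ d))"
    using eventually_gt_at_top[of 0]
  proof eventually_elim
    case (elim R)
    have "1 + (2 + r) / R = (R + 2 + r) / R" "1 - r / R = (R - r) / R"
      using elim by (simp_all add: field_simps)
    then show ?case by (simp only: power_divide diff_divide_distrib[symmetric]) (simp add: mult.commute)
  qed
  ultimately show ?thesis using Lim_transform_eventually by fastforce
qed

subsection \<open>Measurability for the vague topology\<close>

lemma openin_vague_subset: "openin vague_topology U \<Longrightarrow> U \<subseteq> Mp"
proof -
  assume "openin vague_topology U"
  then have "U \<subseteq> topspace vague_topology" by (rule openin_subset)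
  also have "\<dots> \<subseteq> Mp" by (auto simp: vague_topology_def)
  finally show ?thesis .
qed

lemma space_vague_borel [simp]: "space vague_borel = Mp"
  unfolding vague_borel_def using openin_vague_subset by (intro space_measure_of) blast

lemma openin_vague_sets: "openin vague_topology U \<Longrightarrow> U \<in> sets vague_borel"
  unfolding vague_borel_def using openin_vague_subset
  by (subst sets_measure_of) (blast, auto)

text \<open>The preimages of open sets are exactly the generators of the vague topology.\<close>

lemma measurable_integral_Cc:
  assumes "f \<in> Cc"
  shows "(\<lambda>L. \<integral>z. f z \<partial>L :: real) \<in> borel_measurable vague_borel"
proof (rule borel_measurableI)
  fix S :: "real set" assume "open S"
  then have "openin vague_topology {L \<in> Mp. integral\<^sup>L L f \<in> S}"
    unfolding vague_topology_def using assms by (intro topology_generated_by_Basis) auto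
  then have "{L \<in> Mp. integral\<^sup>L L f \<in> S} \<in> sets vague_borel" by (rule openin_vague_sets)
  moreover have "(\<lambda>L. \<integral>z. f z \<partial>L) -` S \<inter> space vague_borel = {L \<in> Mp. integral\<^sup>L L f \<in> S}" by auto
  ultimately show "(\<lambda>L. \<integral>z. f z \<partial>L) -` S \<inter> space vague_borel \<in> sets vague_borel" by simp
qed

text \<open>The cube is open, so its indicator is a pointwise limit of continuous functions
  vanishing outside it. Multiplied by \<open>f\<close> and by the colour indicator, which is
  continuous on a discrete space, they are admissible test functions. Dominated convergence for each
  fixed configuration then gives a pointwise limit of measurable functions.\<close>

lemma measurable_integral_cube:
  fixes f :: "'a::euclidean_space \<Rightarrow> real" and i :: "'m::{finite,discrete_topology}"
  assumes f: "continuous_on UNIV f"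
  shows "(\<lambda>L. \<integral>x. indicator (cube R) x *\<^sub>R f x \<partial>colour_part L i) \<in> borel_measurable vague_borel"
proof -
  \<comment> \<open>A distance cutoff: 0 off the cube, and equal to 1 at any given point of the cube
    as soon as \<open>n\<close> is large.\<close>
  define h where "h n x = min 1 (real n * infdist x (- cube R))" for n and x :: 'a
  define g where "g n z = indicator {i} (snd z) * (h n (fst z) * f (fst z))" for n and z :: "'a \<times> 'm"
  let ?K = "cbox (- (R / 2) *\<^sub>R One) ((R / 2) *\<^sub>R One) \<times> UNIV :: ('a \<times> 'm) set"
  have K: "compact ?K" by (intro compact_Times compact_cbox finite_imp_compact finite)
  have fm: "f \<in> borel_measurable borel" using f by (rule borel_measurable_continuous_onI)
  have cm: "cube R \<in> sets (borel :: 'a measure)" using cube_bounded_borel by (auto simp: bounded_borel_def)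
  have h_bounds: "0 \<le> h n x" "h n x \<le> 1" for n x by (auto simp: h_def infdist_nonneg)
  have h_0: "h n x = 0" if "x \<notin> cube R" for n x using that by (simp add: h_def)
  \<comment> \<open>Needed because \<open>infdist\<close> to the empty set is 0 by
    convention.\<close>
  have ne: "- cube R \<noteq> ({} :: 'a set)"
  proof
    assume "- cube R = ({} :: 'a set)"
    then have "cube R = (UNIV :: 'a set)" by auto
    then show False
      using cube_bounded_borel[of R, where 'a='a] not_bounded_UNIV[where 'a='a]
      by (simp add: bounded_borel_def)
  qed
  have h_lim: "(\<lambda>n. h n x) \<longlonglongrightarrow> indicator (cube R) x" for x
  proof (cases "x \<in> cube R")
    case True
    have "closed (- cube R :: 'a set)" unfolding cube_def by (intro closed_Compl open_box)
    then have pos: "infdist x (- cube R) > 0"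
      using True ne by (simp add: infdist_pos_not_in_closed)
    obtain N :: nat where N: "1 < real N * infdist x (- cube R)"
      using ex_less_of_nat_mult[OF pos] by blast
    have "h n x = 1" if "n \<ge> N" for n
    proof -
      have "real N * infdist x (- cube R) \<le> real n * infdist x (- cube R)"
        using that pos by (intro mult_right_mono) auto
      with N show ?thesis by (simp add: h_def)
    qed
    then have "eventually (\<lambda>n. h n x = indicator (cube R) x) sequentially"
      using True by (auto simp: eventually_sequentially)
    then show ?thesis by (rule tendsto_eventually)
  qed (simp add: h_0)
  have cont: "continuous_on UNIV (g n)" for n
  proof -
    have ind: "continuous_on UNIV (\<lambda>z::'a \<times> 'm. indicator {i} (snd z) :: real)"
      by (rule continuous_on_compose2[OF Topological_Spaces.continuous_on_discrete[of UNIV "indicator {i}"]])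
         (auto intro: continuous_intros)
    have "continuous_on UNIV (\<lambda>z::'a \<times> 'm. h n (fst z))"
      unfolding h_def by (intro continuous_intros)
    moreover have "continuous_on UNIV (\<lambda>z::'a \<times> 'm. f (fst z))"
      by (rule continuous_on_compose2[OF f]) (auto intro: continuous_intros)
    ultimately show ?thesis unfolding g_def using ind by (intro continuous_on_mult)
  qed
  have supp: "g n z = 0" if "z \<notin> ?K" for n z
  proof -
    have "fst z \<notin> cube R" using that box_subset_cbox by (cases z) (auto simp: cube_def)
    then show ?thesis by (simp add: g_def h_0)
  qed
  have Cc: "g n \<in> Cc" for n
    unfolding Cc_def
  proof (intro CollectI conjI cont)
    have "closure {z. g n z \<noteq> 0} \<subseteq> ?K"
      using supp by (intro closure_minimal compact_imp_closed K) auto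
    then have "closure {z. g n z \<noteq> 0} = ?K \<inter> closure {z. g n z \<noteq> 0}" by auto
    then show "compact (closure {z. g n z \<noteq> 0})"
      using compact_Int_closed[OF K closed_closure] by metis
  qed
  have "bounded (f ` cbox (- (R / 2) *\<^sub>R One) ((R / 2) *\<^sub>R One))"
    by (intro compact_imp_bounded compact_continuous_image continuous_on_subset[OF f]) auto
  then obtain B where B: "\<And>x. x \<in> cbox (- (R / 2) *\<^sub>R One) ((R / 2) *\<^sub>R One) \<Longrightarrow> \<bar>f x\<bar> \<le> B"
    unfolding bounded_iff by (metis image_eqI real_norm_def)
  show ?thesis
  proof (rule borel_measurable_LIMSEQ_real)
    show "(\<lambda>L. \<integral>z. g n z \<partial>L) \<in> borel_measurable vague_borel" for n
      by (rule measurable_integral_Cc[OF Cc])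
    fix L :: "('a \<times> 'm) measure" assume "L \<in> space vague_borel"
    then have L: "L \<in> Mp" by simp
    then have sets: "sets L = sets borel" by (simp add: Mp_def)
    have "(\<lambda>n. \<integral>z. g n z \<partial>L) \<longlonglongrightarrow> (\<integral>z. indicator {i} (snd z) * (indicator (cube R) (fst z) *\<^sub>R f (fst z)) \<partial>L)"
    proof (rule integral_dominated_convergence)
      have m: "fst \<in> measurable L borel" "(\<lambda>z. indicator {i} (snd z) :: real) \<in> borel_measurable L"
      proof -
        show "fst \<in> measurable L borel"
          using measurable_fst_snd_borel(1)[where 'a='a and 'b='m] sets by (simp cong: measurable_cong_sets)
        have "(\<lambda>z::'a \<times> 'm. indicator {i} (snd z) :: real) \<in> borel_measurable borel"
          by (intro borel_measurable_continuous_onI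
              continuous_on_compose2[OF Topological_Spaces.continuous_on_discrete[of UNIV "indicator {i}"]])
             (auto intro: continuous_intros)
        then show "(\<lambda>z. indicator {i} (snd z) :: real) \<in> borel_measurable L"
          using sets by (simp cong: measurable_cong_sets)
      qed
      show "(\<lambda>z. indicator {i} (snd z) * (indicator (cube R) (fst z) *\<^sub>R f (fst z))) \<in> borel_measurable L"
        using m fm cm by measurable
      show "g n \<in> borel_measurable L" for n
        using borel_measurable_continuous_onI[OF cont] sets by (simp cong: measurable_cong_sets)
      have "emeasure L ?K < \<infinity>" using L K by (auto simp: Mp_def)
      moreover have "?K \<in> sets L"
        unfolding sets using K by (intro borel_closed compact_imp_closed)
      ultimately show "integrable L (\<lambda>z. B * indicator ?K z)"
        by (intro integrable_mult_right integrable_real_indicator)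
      show "AE z in L. (\<lambda>n. g n z) \<longlonglongrightarrow> indicator {i} (snd z) * (indicator (cube R) (fst z) *\<^sub>R f (fst z))"
        unfolding g_def by (intro AE_I2 tendsto_intros) (auto intro!: tendsto_intros h_lim)
      show "AE z in L. norm (g n z) \<le> B * indicator ?K z" for n
      proof (intro AE_I2)
        fix z
        show "norm (g n z) \<le> B * indicator ?K z"
        proof (cases "z \<in> ?K")
          case True
          then have "\<bar>f (fst z)\<bar> \<le> B" using B by auto
          moreover have "norm (g n z) \<le> 1 * (1 * \<bar>f (fst z)\<bar>)"
            unfolding g_def real_norm_def abs_mult using h_bounds[of n "fst z"]
            by (intro mult_mono) (auto simp: indicator_def)
          ultimately show ?thesis using True by simp
        qed (use supp in auto)
      qed
    qed
    then show "(\<lambda>n. \<integral>z. g n z \<partial>L) \<longlonglongrightarrow> (\<integral>x. indicator (cube R) x *\<^sub>R f x \<partial>colour_part L i)"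
      using integral_colour_part[OF sets, of "\<lambda>x. indicator (cube R) x *\<^sub>R f x" i] fm cm by simp
  qed
qed

text \<open>The vague topology is generated by real test functions, so the wave is split into cosine
  and sine before the previous measurability result is applied.\<close>

lemma measurable_weighted_average:
  fixes w :: "real ^ 'm::{finite,discrete_topology}" and k :: "'a::euclidean_space"
  shows "weighted_average w k R \<in> borel_measurable vague_borel"
proof -
  let ?I = "\<lambda>f L i. \<integral>x. indicator (cube R) x *\<^sub>R f x \<partial>colour_part L i :: real"
  let ?c = "\<lambda>x. cos (2 * pi * (k \<bullet> x))" and ?s = "\<lambda>x. sin (2 * pi * (k \<bullet> x))"
  have eq: "weighted_average w k R L = (\<Sum>i\<in>UNIV. of_real (w $ i) * (of_real (?I ?c L i) + \<i> * of_real (?I ?s L i)))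
      / of_real (measure lborel (cube R :: 'a set))" if "L \<in> Mp" for L :: "('a \<times> 'm) measure"
  proof -
    have "(\<integral>x. indicator (cube R) x *\<^sub>R cis (2 * pi * (k \<bullet> x)) \<partial>colour_part L i)
        = of_real (?I ?c L i) + \<i> * of_real (?I ?s L i)" for i
      unfolding complex_eq_iff
      by (subst (1 2 3 4 5 6) integral_atoms(2)[OF locally_integer_valued_colour_part[OF that] cube_bounded_borel])
         (auto intro!: borel_measurable_continuous_onI continuous_intros)
    then show ?thesis unfolding weighted_average_def
      by (subst infsum_wmeasure_eq_integral[OF that cube_bounded_borel])
         (auto intro!: borel_measurable_continuous_onI continuous_intros)
  qed
  have [measurable]: "(\<lambda>L. ?I ?c L i) \<in> borel_measurable vague_borel"
     "(\<lambda>L. ?I ?s L i) \<in> borel_measurable vague_borel" for i :: 'm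
    by (intro measurable_integral_cube continuous_intros)+
  have "(\<lambda>L. (\<Sum>i\<in>UNIV. of_real (w $ i) * (of_real (?I ?c L i) + \<i> * of_real (?I ?s L i)))
      / of_real (measure lborel (cube R :: 'a set))) \<in> borel_measurable vague_borel"
    by measurable
  then show ?thesis
    by (subst measurable_cong[OF eq]) auto
qed

subsection \<open>Convergence of the averages\<close>

text \<open>The factor 2 replaces the triangle inequality for the L2 norm; it is harmless because
  the bound is only applied to quantities tending to 0.\<close>

lemma L2_diff_bound:
  assumes f: "f \<in> L2 M" and g: "g \<in> L2 M"
  shows "(\<lambda>x. f x - g x) \<in> L2 M"
    and "(L2_norm M (\<lambda>x. f x - g x))^2 \<le> 2 * (L2_norm M f)^2 + 2 * (L2_norm M g)^2"
proof -
  have [measurable]: "f \<in> borel_measurable M" "g \<in> borel_measurable M"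
    using f g by (auto simp: L2_def)
  have i: "integrable M (\<lambda>x. (norm (f x))^2)" "integrable M (\<lambda>x. (norm (g x))^2)"
    using f g by (auto simp: L2_def)
  have b: "integrable M (\<lambda>x. 2 * (norm (f x))^2 + 2 * (norm (g x))^2)"
    using i by (intro Bochner_Integration.integrable_add integrable_mult_right)
  have d: "integrable M (\<lambda>x. (norm (f x - g x))^2)"
    by (rule Bochner_Integration.integrable_bound[OF b]) (use norm_diff_power2_le in auto)
  then show "(\<lambda>x. f x - g x) \<in> L2 M" by (simp add: L2_def)
  have "(\<integral>x. (norm (f x - g x))^2 \<partial>M) \<le> (\<integral>x. 2 * (norm (f x))^2 + 2 * (norm (g x))^2 \<partial>M)"
    by (intro integral_mono d b norm_diff_power2_le)
  also have "\<dots> = 2 * (\<integral>x. (norm (f x))^2 \<partial>M) + 2 * (\<integral>x. (norm (g x))^2 \<partial>M)"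
    using i by (subst Bochner_Integration.integral_add) auto
  finally show "(L2_norm M (\<lambda>x. f x - g x))^2 \<le> 2 * (L2_norm M f)^2 + 2 * (L2_norm M g)^2"
    by (simp add: L2_norm_def)
qed

lemma L2_norm_nonneg: "L2_norm M f \<ge> 0"
  by (simp add: L2_norm_def)

lemma L2_norm_cong_AE:
  assumes "f \<in> borel_measurable M" "g \<in> borel_measurable M" "AE x in M. f x = g x"
  shows "L2_norm M f = L2_norm M g"
  unfolding L2_norm_def using assms by (intro arg_cong[where f = sqrt] integral_cong_AE) auto

lemma L2_bounded_AE:
  assumes "finite_measure M" and f: "f \<in> borel_measurable M" and b: "AE x in M. norm (f x) \<le> c"
  shows "f \<in> L2 M" and "(L2_norm M f)^2 \<le> c^2 * measure M (space M)"
proof -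
  interpret finite_measure M by fact
  have b': "AE x in M. (norm (f x))^2 \<le> c^2"
    using b by eventually_elim (intro power_mono, auto)
  have [measurable]: "f \<in> borel_measurable M" by fact
  have i: "integrable M (\<lambda>x. (norm (f x))^2)"
    using b' by (intro integrable_const_bound[of _ "c^2"]) auto
  then show "f \<in> L2 M" using f by (simp add: L2_def)
  have "(\<integral>x. (norm (f x))^2 \<partial>M) \<le> (\<integral>x. c^2 \<partial>M)"
    using i b' by (intro integral_mono_AE) auto
  then show "(L2_norm M f)^2 \<le> c^2 * measure M (space M)"
    by (simp add: L2_norm_def mult.commute)
qed

text \<open>f - g is the difference of the two errors F - g and F - f, both of which tend to
  0.\<close>

lemma L2_tendsto_unique_norm:
  assumes f: "L2_tendsto M F f" and g: "L2_tendsto M F g"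
  shows "L2_norm M (\<lambda>x. f x - g x) = 0"
proof -
  let ?a = "\<lambda>R. 2 * (L2_norm M (\<lambda>x. F R x - g x))^2 + 2 * (L2_norm M (\<lambda>x. F R x - f x))^2"
  have "(?a \<longlongrightarrow> 2 * 0^2 + 2 * 0^2) at_top"
    using f g unfolding L2_tendsto_def by (intro tendsto_intros) auto
  moreover have "\<forall>\<^sub>F R in at_top. (L2_norm M (\<lambda>x. f x - g x))^2 \<le> ?a R"
  proof -
    have "\<forall>\<^sub>F R in at_top. F R \<in> L2 M" using f by (simp add: L2_tendsto_def)
    then show ?thesis
    proof eventually_elim
      case (elim R)
      have fg: "f \<in> L2 M" "g \<in> L2 M" using f g by (auto simp: L2_tendsto_def)
      show ?case
        using L2_diff_bound(2)[OF L2_diff_bound(1)[OF elim fg(2)] L2_diff_bound(1)[OF elim fg(1)]] by simp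
    qed
  qed
  ultimately have "(L2_norm M (\<lambda>x. f x - g x))^2 \<le> 2 * 0^2 + 2 * 0^2"
    by (intro tendsto_lowerbound) auto
  then show ?thesis by simp
qed

lemma L2_tendsto_weighted_average:
  fixes \<mu> :: "('a::euclidean_space \<times> 'm::{finite,discrete_topology}) measure measure"
  assumes pp: "point_process X \<mu>"
    and ft: "is_fourier_transform \<nu> \<rho>"
    and th: "is_theta (restrict_space \<mu> X) w \<rho> \<theta>"
  shows "L2_tendsto (restrict_space \<mu> X) (weighted_average w k) (\<theta> (indicator {k}))"
proof -
  let ?P = "restrict_space \<mu> X"
  let ?d = "DIM('a)"
  have sets_\<mu>: "sets \<mu> = sets vague_borel" and "prob_space \<mu>" and supp: "is_support \<mu> X"
    using pp by (auto simp: point_process_def)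
  obtain r where r: "r > 0" and X: "X \<subseteq> Mp_cube r" using pp by (auto simp: point_process_def)
  interpret prob_space \<mu> by fact
  \<comment> \<open>A support is vaguely closed, hence measurable, so restricting to it gives a
    finite measure, on which uniform bounds become L2 bounds.\<close>
  have "X \<in> sets \<mu>"
  proof -
    have "openin vague_topology (topspace vague_topology - X)" and "X \<subseteq> topspace vague_topology"
      using supp by (auto simp: is_support_def closedin_def)
    then have "topspace vague_topology - (topspace vague_topology - X) \<in> sets vague_borel"
      by (intro sets.Diff openin_vague_sets) auto
    then show ?thesis using \<open>X \<subseteq> topspace vague_topology\<close> by (simp add: sets_\<mu> double_diff)
  qed
  then have P: "finite_measure ?P"
    by (rule finite_measure_restrict_space[OF finite_measure_axioms])
  have space_P: "L \<in> Mp_cube r" if "L \<in> space ?P" for L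
    using that X by (auto simp: space_restrict_space)
  have sets: "sets \<rho> = sets borel" and tb: "translation_bounded \<rho>"
    using ft by (auto simp: is_fourier_transform_def)
  note \<rho> = L2_fourier_plateau_wave[OF sets tb]
  have \<theta>L2: "\<And>f. f \<in> L2 \<rho> \<Longrightarrow> \<theta> f \<in> L2 ?P" and \<theta>norm: "\<And>f. f \<in> L2 \<rho> \<Longrightarrow> L2_norm ?P (\<theta> f) = L2_norm \<rho> f"
    and \<theta>lin: "\<And>f g a b. f \<in> L2 \<rho> \<Longrightarrow> g \<in> L2 \<rho> \<Longrightarrow>
        AE L in ?P. \<theta> (\<lambda>x. a * f x + b * g x) L = a * \<theta> f L + b * \<theta> g L"
    and \<theta>N: "\<And>f. f \<in> schwartz \<Longrightarrow> AE L in ?P. \<theta> (fourier f) L = counting_fun w f L"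
    using th unfolding is_theta_def by blast+
  define \<epsilon> where "\<epsilon> R = (\<Sum>i\<in>UNIV. \<bar>w $ i\<bar>) * (((R + 2 + r) ^ ?d - (R - r) ^ ?d) / (r ^ ?d * R ^ ?d))" for R
  define \<phi> where "\<phi> R = fourier (plateau_wave k R)" for R
  let ?A = "weighted_average w k"
  have A_meas: "?A R \<in> borel_measurable ?P" for R
    using measurable_weighted_average[of w k R]
    by (intro measurable_restrict_space1) (simp add: sets_\<mu> cong: measurable_cong_sets)
  have 1: "(\<lambda>L. \<theta> (\<phi> R) L - ?A R L) \<in> L2 ?P"
    "(L2_norm ?P (\<lambda>L. \<theta> (\<phi> R) L - ?A R L))^2 \<le> (\<epsilon> R)^2 * measure ?P (space ?P)"
    if R: "R \<ge> 1" "R \<ge> r" for R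
  proof -
    have "AE L in ?P. norm (\<theta> (\<phi> R) L - ?A R L) \<le> \<epsilon> R"
      using \<theta>N[OF schwartz_plateau_wave[of k R]] AE_space[of ?P]
    proof eventually_elim
      case (elim L)
      then show ?case
        using counting_fun_minus_weighted_average_le[OF space_P[OF elim(2)] r R, of w k]
        by (simp add: \<phi>_def \<epsilon>_def)
    qed
    moreover have "(\<lambda>L. \<theta> (\<phi> R) L - ?A R L) \<in> borel_measurable ?P"
      using A_meas \<theta>L2[OF \<rho>(1)[OF R(1), of k]]
      by (intro borel_measurable_diff) (simp_all add: L2_def \<phi>_def)
    ultimately show "(\<lambda>L. \<theta> (\<phi> R) L - ?A R L) \<in> L2 ?P"
      "(L2_norm ?P (\<lambda>L. \<theta> (\<phi> R) L - ?A R L))^2 \<le> (\<epsilon> R)^2 * measure ?P (space ?P)"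
      using L2_bounded_AE[OF P] by blast+
  qed
  have 2: "(\<lambda>L. \<theta> (\<phi> R) L - \<theta> (indicator {k}) L) \<in> L2 ?P"
    "L2_norm ?P (\<lambda>L. \<theta> (\<phi> R) L - \<theta> (indicator {k}) L) = L2_norm \<rho> (\<lambda>y. \<phi> R y - indicator {k} y)"
    if R: "R \<ge> 1" for R
  proof -
    have \<phi>: "\<phi> R \<in> L2 \<rho>" unfolding \<phi>_def by (rule \<rho>(1)[OF R])
    show L: "(\<lambda>L. \<theta> (\<phi> R) L - \<theta> (indicator {k}) L) \<in> L2 ?P"
      by (intro L2_diff_bound \<theta>L2 \<phi> \<rho>(2))
    have L': "(\<lambda>y. \<phi> R y - indicator {k} y) \<in> L2 \<rho>"
      by (intro L2_diff_bound \<phi> \<rho>(2))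
    \<comment> \<open>Linearity of \<open>\<theta>\<close> holds only up to null sets, so the
      isometry is applied to the image of the difference and the norms are compared almost
      everywhere.\<close>
    have "AE L in ?P. \<theta> (\<phi> R) L - \<theta> (indicator {k}) L = \<theta> (\<lambda>y. \<phi> R y - indicator {k} y) L"
      using \<theta>lin[OF \<phi> \<rho>(2)[of k], of 1 "-1"] by eventually_elim simp
    then have "L2_norm ?P (\<lambda>L. \<theta> (\<phi> R) L - \<theta> (indicator {k}) L) = L2_norm ?P (\<theta> (\<lambda>y. \<phi> R y - indicator {k} y))"
      using L \<theta>L2[OF L'] by (intro L2_norm_cong_AE) (auto simp: L2_def)
    also have "\<dots> = L2_norm \<rho> (\<lambda>y. \<phi> R y - indicator {k} y)" by (rule \<theta>norm[OF L'])
    finally show "L2_norm ?P (\<lambda>L. \<theta> (\<phi> R) L - \<theta> (indicator {k}) L) = L2_norm \<rho> (\<lambda>y. \<phi> R y - indicator {k} y)" .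
  qed
  \<comment> \<open>The squared distance of the average from its limit is at most twice the squared
    isometry error plus twice the squared shell error.\<close>
  let ?b = "\<lambda>R. 2 * (L2_norm \<rho> (\<lambda>y. \<phi> R y - indicator {k} y))^2 + 2 * ((\<epsilon> R)^2 * measure ?P (space ?P))"
  have b0: "(?b \<longlongrightarrow> 2 * 0^2 + 2 * (0^2 * measure ?P (space ?P))) at_top"
    unfolding \<epsilon>_def \<phi>_def by (intro tendsto_intros \<rho>(3) tendsto_shell_volume r)
  show ?thesis
    unfolding L2_tendsto_def
  proof (intro conjI)
    show "\<forall>\<^sub>F R in at_top. ?A R \<in> L2 ?P"
      using eventually_ge_at_top[of 1] eventually_ge_at_top[of r]
    proof eventually_elim
      case (elim R)
      have "\<theta> (\<phi> R) \<in> L2 ?P" unfolding \<phi>_def by (rule \<theta>L2[OF \<rho>(1)[OF elim(1)]])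
      from L2_diff_bound(1)[OF this 1(1)[OF elim]] show ?case by simp
    qed
    show "\<theta> (indicator {k}) \<in> L2 ?P" by (rule \<theta>L2[OF \<rho>(2)])
    have "((\<lambda>R. (L2_norm ?P (\<lambda>L. ?A R L - \<theta> (indicator {k}) L))^2) \<longlongrightarrow> 0) at_top"
    proof (rule Lim_null_comparison)
      show "\<forall>\<^sub>F R in at_top. norm ((L2_norm ?P (\<lambda>L. ?A R L - \<theta> (indicator {k}) L))^2) \<le> ?b R"
        using eventually_ge_at_top[of 1] eventually_ge_at_top[of r]
      proof eventually_elim
        case (elim R)
        show ?case
          using L2_diff_bound(2)[OF 2(1)[OF elim(1)] 1(1)[OF elim]] 1(2)[OF elim] 2(2)[OF elim(1)]
          by simp
      qed
    qed (use b0 in auto)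
    then have "((\<lambda>R. sqrt ((L2_norm ?P (\<lambda>L. ?A R L - \<theta> (indicator {k}) L))^2)) \<longlongrightarrow> sqrt 0) at_top"
      by (rule tendsto_real_sqrt)
    then show "((\<lambda>R. L2_norm ?P (\<lambda>L. ?A R L - \<theta> (indicator {k}) L)) \<longlongrightarrow> 0) at_top"
      by (simp add: L2_norm_nonneg)
  qed
qed

lemma L2_norm_indicator_sing:
  assumes "sets \<rho> = sets borel"
  shows "L2_norm \<rho> (indicator {k :: 'a::euclidean_space}) = sqrt (measure \<rho> {k})"
proof -
  have "(\<lambda>x. (norm (indicator {k} x :: complex))^2) = (indicator {k} :: 'a \<Rightarrow> real)"
    by (auto simp: indicator_def)
  moreover have "space \<rho> = UNIV" using sets_eq_imp_space_eq[OF assms] by simp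
  ultimately show ?thesis by (simp add: L2_norm_def)
qed

text \<open>The averages already have the limit \<open>\<theta> (indicator {k})\<close>, whose norm
  is the square root of the mass at \<open>k\<close>; a second limit 0 is possible exactly when that
  norm vanishes.\<close>

lemma L2_tendsto_weighted_average_0_iff:
  fixes \<mu> :: "('a::euclidean_space \<times> 'm::{finite,discrete_topology}) measure measure"
  assumes pp: "point_process X \<mu>"
    and ft: "is_fourier_transform \<nu> \<rho>"
    and th: "is_theta (restrict_space \<mu> X) w \<rho> \<theta>"
  shows "L2_tendsto (restrict_space \<mu> X) (weighted_average w k) (\<lambda>_. 0) \<longleftrightarrow> emeasure \<rho> {k} = 0"
proof -
  let ?P = "restrict_space \<mu> X"
  let ?t = "\<theta> (indicator {k})"
  note lim = L2_tendsto_weighted_average[OF assms, of k]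
  have sets: "sets \<rho> = sets borel" and tb: "translation_bounded \<rho>"
    using ft by (auto simp: is_fourier_transform_def)
  \<comment> \<open>\<open>measure\<close> is also 0 on sets of infinite mass, which translation
    boundedness excludes here.\<close>
  have "emeasure \<rho> {k} < \<infinity>"
    using translation_bounded_emeasure_compact[OF tb, of "{k}"] by simp
  then have em: "emeasure \<rho> {k} = 0 \<longleftrightarrow> measure \<rho> {k} = 0"
    by (auto simp: measure_def enn2real_eq_0_iff)
  have t: "?t \<in> L2 ?P" using lim by (simp add: L2_tendsto_def)
  have norm_t: "L2_norm ?P ?t = sqrt (measure \<rho> {k})"
    using th L2_fourier_plateau_wave(2)[OF sets tb, of k] L2_norm_indicator_sing[OF sets, of k]
    unfolding is_theta_def by auto
  show ?thesis
  proof
    assume "L2_tendsto ?P (weighted_average w k) (\<lambda>_. 0)"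
    from L2_tendsto_unique_norm[OF lim this] show "emeasure \<rho> {k} = 0"
      using norm_t em by simp
  next
    assume "emeasure \<rho> {k} = 0"
    then have 0: "(\<integral>L. (norm (?t L))^2 \<partial>?P) = 0"
      using norm_t em by (simp add: L2_norm_def)
    have "AE L in ?P. (norm (?t L))^2 = 0"
      using 0 t by (subst integral_nonneg_eq_0_iff_AE[symmetric]) (auto simp: L2_def)
    then have AE: "AE L in ?P. ?t L = 0" by simp
    have F: "\<forall>\<^sub>F R in at_top. weighted_average w k R \<in> L2 ?P" using lim by (simp add: L2_tendsto_def)
    moreover have "\<forall>\<^sub>F R in at_top. L2_norm ?P (\<lambda>L. weighted_average w k R L - ?t L)
        = L2_norm ?P (\<lambda>L. weighted_average w k R L - 0)"
      using F
    proof eventually_elim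
      case (elim R)
      then show ?case using t AE by (intro L2_norm_cong_AE) (auto simp: L2_def)
    qed
    then have "((\<lambda>R. L2_norm ?P (\<lambda>L. weighted_average w k R L - 0)) \<longlongrightarrow> 0) at_top"
      using lim by (simp add: L2_tendsto_def tendsto_cong)
    ultimately show "L2_tendsto ?P (weighted_average w k) (\<lambda>_. 0)"
      by (auto simp: L2_tendsto_def L2_def)
  qed
qed

section \<open>Symmetry of the atoms under reflection\<close>

lemma weighted_average_uminus:
  fixes k :: "'a::euclidean_space"
  shows "weighted_average w (- k) R L = cnj (weighted_average w k R L)"
proof -
  have "cnj (weighted_average w k R L)
      = (\<Sum>\<^sub>\<infinity>x\<in>cube R. cnj (of_real (wmeasure w L {x}) * cis (2 * pi * (k \<bullet> x))))
       / of_real (measure lborel (cube R :: 'a set))"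
    unfolding weighted_average_def complex_cnj_divide infsum_cnj by simp
  also have "\<dots> = weighted_average w (- k) R L"
    by (simp add: weighted_average_def cis_cnj)
  finally show ?thesis by simp
qed

lemma L2_tendsto_0_cnj:
  "L2_tendsto M (\<lambda>R x. cnj (F R x)) (\<lambda>_. 0)" if "L2_tendsto M F (\<lambda>_. 0)"
proof -
  have "\<forall>\<^sub>F R in at_top. F R \<in> L2 M" using that by (simp add: L2_tendsto_def)
  then have "\<forall>\<^sub>F R in at_top. (\<lambda>x. cnj (F R x)) \<in> L2 M"
    by eventually_elim (auto simp: L2_def intro!: borel_measurable_continuous_on[OF continuous_on_cnj[OF continuous_on_id]])
  then show ?thesis using that by (simp add: L2_tendsto_def L2_norm_def)
qed

text \<open>
  The weights are real, so the averages at \<open>k\<close> and \<open>- k\<close> are conjugate and have the same \<open>L2\<close> norms.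
\<close>

lemma emeasure_sing_uminus:
  fixes \<mu> :: "('a::euclidean_space \<times> 'm::{finite,discrete_topology}) measure measure"
  assumes "point_process X \<mu>" "is_fourier_transform \<nu> \<rho>" "is_theta (restrict_space \<mu> X) w \<rho> \<theta>"
  shows "emeasure \<rho> {- k} = 0 \<longleftrightarrow> emeasure \<rho> {k} = 0"
proof -
  have *: "emeasure \<rho> {- k} = 0" if "emeasure \<rho> {k} = 0" for k
  proof -
    have "L2_tendsto (restrict_space \<mu> X) (weighted_average w k) (\<lambda>_. 0)"
      using that L2_tendsto_weighted_average_0_iff[OF assms] by blast
    from L2_tendsto_0_cnj[OF this]
    have "L2_tendsto (restrict_space \<mu> X) (weighted_average w (- k)) (\<lambda>_. 0)"
      by (simp add: weighted_average_uminus[abs_def])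
    then show ?thesis using L2_tendsto_weighted_average_0_iff[OF assms] by blast
  qed
  from *[of k] *[of "- k"] show ?thesis by auto
qed

section \<open>Eigenvalues of the multiplication representation\<close>

text \<open>A single \<open>n\<close> with \<open>Suc n\<close> above |u| decides: the quotient is
  an integer of absolute value below 1. All \<open>n\<close> are assumed because \<open>u\<close>
  will depend on the point while the family of translations must not.\<close>

lemma eq_0_if_cis_divide_eq_1:
  assumes "\<And>n::nat. cis (2 * pi * (u / real (Suc n))) = 1"
  shows "u = 0"
proof (rule ccontr)
  assume "u \<noteq> 0"
  obtain n :: nat where n: "\<bar>u\<bar> < real (Suc n)"
    using reals_Archimedean2[of "\<bar>u\<bar>"] by (metis less_Suc_eq of_nat_less_iff order.strict_trans)
  from assms[of n] have "cos (2 * pi * (u / real (Suc n))) = 1"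
    by (metis cis.simps(1) one_complex.simps(1))
  then obtain m :: int where m: "2 * pi * (u / real (Suc n)) = of_int m * 2 * pi"
    unfolding cos_one_2pi_int by blast
  then have "(2 * pi) * (u / real (Suc n)) = (2 * pi) * of_int m" by (simp only: mult_ac)
  then have m': "u / real (Suc n) = of_int m"
    using pi_neq_zero by (subst (asm) mult_left_cancel) auto
  have "\<bar>u / real (Suc n)\<bar> < 1" using n by (simp add: abs_divide)
  then have "\<bar>m\<bar> < 1" unfolding m' by linarith
  then have "u / real (Suc n) = 0" using m' by simp
  then show False using \<open>u \<noteq> 0\<close> by simp
qed

text \<open>Since \<open>U_op\<close> multiplies by the conjugate character, the eigenfunctions for \<open>k\<close> live on \<open>{- k}\<close>.\<close>

lemma U_eigenvalue_iff:
  fixes \<rho> :: "'a::euclidean_space measure"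
  assumes sets: "sets \<rho> = sets borel" and tb: "translation_bounded \<rho>"
  shows "U_eigenvalue \<rho> k \<longleftrightarrow> emeasure \<rho> {- k} \<noteq> 0"
proof
  assume "U_eigenvalue \<rho> k"
  then obtain f where nz: "\<not> (AE x in \<rho>. f x = 0)"
    and ev: "\<And>t. AE x in \<rho>. U_op t f x = cis (2 * pi * (k \<bullet> t)) * f x"
    unfolding U_eigenvalue_def by blast
  \<comment> \<open>The exceptional null set of the eigenvalue equation depends on \<open>t\<close>,
    so only countably many \<open>t\<close> can be treated together. The fractions of basis vectors
    suffice to determine the point.\<close>
  have "AE x in \<rho>. \<forall>b\<in>Basis. \<forall>n::nat. U_op ((1 / real (Suc n)) *\<^sub>R b) f x
      = cis (2 * pi * (k \<bullet> ((1 / real (Suc n)) *\<^sub>R b))) * f x"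
    by (intro AE_ball_countable' countable_finite finite_Basis AE_all_countable[THEN iffD2] allI ev)
  then have AE: "AE x in \<rho>. f x \<noteq> 0 \<longrightarrow> x = - k"
  proof eventually_elim
    case (elim x)
    show ?case
    proof
      assume fx: "f x \<noteq> 0"
      have "(k + x) \<bullet> b = 0" if b: "b \<in> Basis" for b
      proof (rule eq_0_if_cis_divide_eq_1)
        fix n :: nat
        let ?t = "(1 / real (Suc n)) *\<^sub>R b"
        have "cis (- 2 * pi * (?t \<bullet> x)) * f x = cis (2 * pi * (k \<bullet> ?t)) * f x"
          using elim b unfolding U_op_def by blast
        then have "cis (2 * pi * (k \<bullet> ?t)) = cis (- 2 * pi * (?t \<bullet> x))"
          using fx by simp
        then have "cis (2 * pi * (?t \<bullet> x)) * cis (2 * pi * (k \<bullet> ?t))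
            = cis (2 * pi * (?t \<bullet> x)) * cis (- 2 * pi * (?t \<bullet> x))" by simp
        then have "cis (2 * pi * (?t \<bullet> x) + 2 * pi * (k \<bullet> ?t)) = 1"
          by (simp add: cis_mult)
        moreover have "2 * pi * (?t \<bullet> x) + 2 * pi * (k \<bullet> ?t) = 2 * pi * (((k + x) \<bullet> b) / real (Suc n))"
          by (simp add: inner_commute inner_add_right inner_add_left add_divide_distrib algebra_simps)
        ultimately show "cis (2 * pi * (((k + x) \<bullet> b) / real (Suc n))) = 1" by simp
      qed
      then have "k + x = 0" using euclidean_all_zero_iff by blast
      then show "x = - k" by (simp add: eq_neg_iff_add_eq_0 add.commute)
    qed
  qed
  show "emeasure \<rho> {- k} \<noteq> 0"
  proof
    assume "emeasure \<rho> {- k} = 0"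
    then have "{- k} \<in> null_sets \<rho>" using sets by (simp add: null_sets_def)
    then have "AE x in \<rho>. x \<notin> {- k}" by (rule AE_not_in)
    with AE have "AE x in \<rho>. f x = 0" by eventually_elim auto
    with nz show False by blast
  qed
next
  assume nz: "emeasure \<rho> {- k} \<noteq> 0"
  have "\<not> (AE x in \<rho>. indicator {- k} x = (0::complex))"
  proof
    assume "AE x in \<rho>. indicator {- k} x = (0::complex)"
    then have "AE x in \<rho>. x \<notin> {- k}" by eventually_elim (auto simp: indicator_def)
    then have "{- k} \<in> null_sets \<rho>" using sets by (subst AE_iff_null_sets) auto
    with nz show False by (simp add: null_sets_def)
  qed
  then show "U_eigenvalue \<rho> k"
    unfolding U_eigenvalue_def
    by (intro bexI[of _ "indicator {- k}"] conjI allI AE_I2 L2_fourier_plateau_wave(2)[OF sets tb])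
       (auto simp: U_op_def indicator_def inner_commute)
qed

theorem theorem6:
  fixes \<mu> :: "((real ^ 'd) \<times> 'm::{finite,discrete_topology}) measure measure"
    and X :: "((real ^ 'd) \<times> 'm) measure set"
    and w :: "real ^ 'm::{finite,discrete_topology}"
    and k :: "real ^ 'd"
    and \<nu> :: "(real ^ 'd) set \<Rightarrow> real"
    and \<rho> :: "(real ^ 'd) measure"
    and \<theta> :: "((real ^ 'd) \<Rightarrow> complex) \<Rightarrow> ((real ^ 'd) \<times> 'm) measure \<Rightarrow> complex"
  assumes "point_process X \<mu>"
    and "is_first_moment (restrict_space \<mu> X) w \<nu>"
    and "is_fourier_transform \<nu> \<rho>"
    and "is_theta (restrict_space \<mu> X) w \<rho> \<theta>"
  shows "(\<not> L2_tendsto (restrict_space \<mu> X) (weighted_average w k) (\<lambda>_. 0)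
            \<longleftrightarrow> emeasure \<rho> {k} \<noteq> 0)
       \<and> (emeasure \<rho> {k} \<noteq> 0 \<longleftrightarrow> U_eigenvalue \<rho> k)
       \<and> (U_eigenvalue \<rho> k \<longrightarrow>
            L2_tendsto (restrict_space \<mu> X) (weighted_average w k) (\<theta> (indicator {k})))"
  proof -
  note ft = assms(3)
  \<comment> \<open>The eigenvalue criterion speaks of the atom at \<open>- k\<close>; reflection
    symmetry moves it to \<open>k\<close>.\<close>
  have "U_eigenvalue \<rho> k \<longleftrightarrow> emeasure \<rho> {k} \<noteq> 0"
    using U_eigenvalue_iff emeasure_sing_uminus[OF assms(1) ft assms(4)] ft
    by (auto simp: is_fourier_transform_def)
  then show ?thesis
    using L2_tendsto_weighted_average_0_iff[OF assms(1) ft assms(4)]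
      L2_tendsto_weighted_average[OF assms(1) ft assms(4)] by blast
qed

end
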